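(* If $H_\mu^{\mathrm{stab}}(\mathbb{P}^0)$ is non-trivial (contains an element other than the identity) for some, and hence all, $\mathbb{P}^0\in\mathcal{P}_\mu^{\mathrm{ex}}$, then $\mathcal{P}_\mu^{\mathrm{strong}}=\emptyset$.
   Context: $\mathbb{N}=\{1,2,\dots\}$. Let $(G_k)_{k\in\mathbb{N}}$ be a sequence of compact Hausdorff groups with countable bases, let $\phi_k:G_{k+1}\to G_k$ be a continuous homomorphism for each $k$, and let $G:=\prod_{k\in\mathbb{N}}G_k$ with the product topology. Let $\mu=(\mu_k)_{k\in\mathbb{N}}$, where $\mu_k$ is a Borel probability measure on $G_k$. Let $H:=\{(g_k)_{k\in\mathbb{N}}\in G: g_k=\phi_k(g_{k+1})\ \text{for all } k\in\mathbb{N}\}$, a compact subgroup of $G$. Let $X_k:G\to G_k$ be the $k$-th coordinate map and $Z_k:=\phi_k(X_{k+1})^{-1}X_k$. The set $\mathcal{P}_\mu$ of solutions of the stochastic equation associated with $\mu$ is the set of Borel probability measures $\mathbb{P}$ on $G$ such that for every $k\in\mathbb{N}$ and every bounded Borel $f:G_k\to\mathbb{R}$, the conditional expectation of $f(X_k)$ given $(X_j)_{j>k}$ under $\mathbb{P}$ equals $\int_{G_k}f(\phi_k(X_{k+1})z)\,\mu_k(dz)$ $\mathbb{P}$-a.s.; equivalently, for every $k$, under $\mathbb{P}$ the variable $Z_k$ has distribution $\mu_k$ and is independent of $(X_j)_{j>k}$. The set $\mathcal{P}_\mu$ is convex (and compact for weak convergence), and $\mathcal{P}_\mu^{\mathrm{ex}}$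 denotes its set of extreme points. A solution $\mathbb{P}\in\mathcal{P}_\mu$ is strong if for each $k\in\mathbb{N}$ the variable $X_k$ is measurable, up to $\mathbb{P}$-null sets, with respect to $\sigma((Z_j)_{j\ge k})$; $\mathcal{P}_\mu^{\mathrm{strong}}$ denotes the set of strong solutions. For $h=(h_k)_{k\in\mathbb{N}}\in H$ and $\mathbb{P}\in\mathcal{P}_\mu$, $T_h(\mathbb{P})$ is the distribution of $(h_kX_k)_{k\in\mathbb{N}}$ under $\mathbb{P}$. This defines a group action of $H$ on $\mathcal{P}_\mu$ that leaves $\mathcal{P}_\mu^{\mathrm{ex}}$ invariant. For $\mathbb{P}^0\in\mathcal{P}_\mu^{\mathrm{ex}}$, $H_\mu^{\mathrm{stab}}(\mathbb{P}^0):=\{h\in H: T_h(\mathbb{P}^0)=\mathbb{P}^0\}$. *)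

theory Defs
  imports "HOL-Probability.Probability" "HOL-Algebra.Product_Groups"
begin

text \<open>
  The groups \<open>G k\<close> of the sequence are record groups over one common carrier type, each with a
  topology \<open>T k\<close> on its carrier. Since a sequence of sets always embeds into a single type, this
  does not restrict the sequence. The index set \<open>{1, 2, \<dots>}\<close> is relabelled as \<^typ>\<open>nat\<close>.
\<close>

definition topological_group :: "('a, 'b) monoid_scheme \<Rightarrow> 'a topology \<Rightarrow> bool" where
  "topological_group G T \<longleftrightarrow>
     group G \<and> topspace T = carrier G \<and>
     continuous_map (prod_topology T T) T (\<lambda>(x, y). x \<otimes>\<^bsub>G\<^esub> y) \<and>
     continuous_map T T (\<lambda>x. inv\<^bsub>G\<^esub> x)"

definition borel_of :: "'a topology \<Rightarrow> 'a measure" where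
  "borel_of T = sigma (topspace T) {U. openin T U}"

definition borel_prob_measure :: "'a topology \<Rightarrow> 'a measure \<Rightarrow> bool" where
  "borel_prob_measure T M \<longleftrightarrow> prob_space M \<and> sets M = sets (borel_of T)"

text \<open>The \<open>\<sigma>\<close>-algebra on \<open>\<Omega>\<close> generated by the maps \<open>Y i :: \<Omega> \<rightarrow> N i\<close>, \<open>i \<in> I\<close>.\<close>

definition sigma_gen_by :: "'b set \<Rightarrow> 'i set \<Rightarrow> ('i \<Rightarrow> 'b \<Rightarrow> 'a) \<Rightarrow> ('i \<Rightarrow> 'a measure) \<Rightarrow> 'b measure" where
  "sigma_gen_by \<Omega> I Y N = sigma \<Omega> (\<Union>i\<in>I. {Y i -` A \<inter> \<Omega> | A. A \<in> sets (N i)})"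

text \<open>Points of \<open>\<Prod>\<^sub>k G k\<close> are functions \<open>x\<close> with \<open>x k \<in> carrier (G k)\<close>; the coordinate map
  \<open>X\<^sub>k\<close> is \<open>\<lambda>x. x k\<close>.\<close>

definition future :: "(nat \<Rightarrow> 'a topology) \<Rightarrow> nat \<Rightarrow> (nat \<Rightarrow> 'a) measure" where
  "future T k =
     sigma_gen_by (topspace (product_topology T UNIV)) {k<..} (\<lambda>j x. x j) (\<lambda>j. borel_of (T j))"

definition solutions ::
  "(nat \<Rightarrow> ('a, 'b) monoid_scheme) \<Rightarrow> (nat \<Rightarrow> 'a topology) \<Rightarrow> (nat \<Rightarrow> 'a \<Rightarrow> 'a) \<Rightarrow>
     (nat \<Rightarrow> 'a measure) \<Rightarrow> (nat \<Rightarrow> 'a) measure set" where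
  "solutions G T \<phi> \<mu> =
     {P. borel_prob_measure (product_topology T UNIV) P \<and>
         (\<forall>k. \<forall>f :: 'a \<Rightarrow> real.
            f \<in> borel_measurable (borel_of (T k)) \<and> bounded (f ` topspace (T k)) \<longrightarrow>
            (AE x in P. real_cond_exp P (future T k) (\<lambda>x. f (x k)) x =
                        (\<integral>z. f (\<phi> k (x (Suc k)) \<otimes>\<^bsub>G k\<^esub> z) \<partial>\<mu> k)))}"

text \<open>Convex combinations of measures are taken setwise.\<close>

definition extreme_measures :: "'a measure set \<Rightarrow> 'a measure set" where
  "extreme_measures \<P> =
     {P \<in> \<P>. \<forall>Q\<in>\<P>. \<forall>R\<in>\<P>. \<forall>t::real. 0 < t \<and> t < 1 \<and>
         (\<forall>A\<in>sets P. measure P A = t * measure Q A + (1 - t) * measure R A)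
         \<longrightarrow> Q = P \<and> R = P}"

definition noise ::
  "(nat \<Rightarrow> ('a, 'b) monoid_scheme) \<Rightarrow> (nat \<Rightarrow> 'a \<Rightarrow> 'a) \<Rightarrow> nat \<Rightarrow> (nat \<Rightarrow> 'a) \<Rightarrow> 'a" where
  "noise G \<phi> k x = inv\<^bsub>G k\<^esub> (\<phi> k (x (Suc k))) \<otimes>\<^bsub>G k\<^esub> x k"

definition noise_future ::
  "(nat \<Rightarrow> ('a, 'b) monoid_scheme) \<Rightarrow> (nat \<Rightarrow> 'a topology) \<Rightarrow> (nat \<Rightarrow> 'a \<Rightarrow> 'a) \<Rightarrow> nat \<Rightarrow>
     (nat \<Rightarrow> 'a) measure" where
  "noise_future G T \<phi> k =
     sigma_gen_by (topspace (product_topology T UNIV)) {k..} (noise G \<phi>) (\<lambda>j. borel_of (T j))"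

text \<open>Measurability up to null sets is measurability with respect to the \<open>\<sigma>\<close>-algebra generated by
  \<open>(Z\<^sub>j)\<^sub>j\<^sub>\<ge>\<^sub>k\<close> together with the null sets of \<open>P\<close>.\<close>

definition strong_solutions ::
  "(nat \<Rightarrow> ('a, 'b) monoid_scheme) \<Rightarrow> (nat \<Rightarrow> 'a topology) \<Rightarrow> (nat \<Rightarrow> 'a \<Rightarrow> 'a) \<Rightarrow>
     (nat \<Rightarrow> 'a measure) \<Rightarrow> (nat \<Rightarrow> 'a) measure set" where
  "strong_solutions G T \<phi> \<mu> =
     {P \<in> solutions G T \<phi> \<mu>. \<forall>k.
        (\<lambda>x. x k) \<in> measurable (sigma (space P) (sets (noise_future G T \<phi> k) \<union> null_sets P))
                             (borel_of (T k))}"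

definition H_group ::
  "(nat \<Rightarrow> ('a, 'b) monoid_scheme) \<Rightarrow> (nat \<Rightarrow> 'a \<Rightarrow> 'a) \<Rightarrow> (nat \<Rightarrow> 'a) set" where
  "H_group G \<phi> = {g \<in> carrier (product_group UNIV G). \<forall>k. g k = \<phi> k (g (Suc k))}"

definition translate ::
  "(nat \<Rightarrow> ('a, 'b) monoid_scheme) \<Rightarrow> (nat \<Rightarrow> 'a topology) \<Rightarrow> (nat \<Rightarrow> 'a) \<Rightarrow>
     (nat \<Rightarrow> 'a) measure \<Rightarrow> (nat \<Rightarrow> 'a) measure" where
  "translate G T h P =
     distr P (borel_of (product_topology T UNIV)) (\<lambda>x k. h k \<otimes>\<^bsub>G k\<^esub> x k)"

definition H_stab ::
  "(nat \<Rightarrow> ('a, 'b) monoid_scheme) \<Rightarrow> (nat \<Rightarrow> 'a topology) \<Rightarrow> (nat \<Rightarrow> 'a \<Rightarrow> 'a) \<Rightarrow>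
     (nat \<Rightarrow> 'a) measure \<Rightarrow> (nat \<Rightarrow> 'a) set" where
  "H_stab G T \<phi> P = {h \<in> H_group G \<phi>. translate G T h P = P}"

end

theory Submission
  imports Defs
begin

text \<open>
  The heart of the matter is that \<open>H\<close> acts transitively on the extreme solutions
  (\<open>extreme_transitive\<close>). Then the stabilisers of any two of them are conjugate
  (\<open>stabiliser_conjugate\<close>), so either all of them are trivial or none is. A strong solution is
  extreme, and its stabiliser is trivial, because translation by \<open>H\<close> leaves the noise
  \<open>(Z\<^sub>k)\<close> unchanged while the noise determines the point almost surely. So a strong solution
  cannot coexist with an extreme solution that has a non-trivial stabiliser.

  A solution is characterised by resampling. Replace the coordinate \<open>x\<^sub>k\<close> by
  \<open>\<phi>\<^sub>k(x\<^sub>k\<^sub>+\<^sub>1) z\<close>, where \<open>z\<close> has law \<open>\<mu>\<^sub>k\<close>: this preserves the law of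
  \<open>(x\<^sub>j)\<^sub>j\<^sub>\<ge>\<^sub>k\<close>, for every \<open>k\<close> (\<open>solutions_iff\<close>). Resampling the coordinates
  \<open>0, \<dots>, n - 1\<close> and averaging turns a test function \<open>f\<close> into a function \<open>avg n f\<close> of the
  coordinates from \<open>n\<close> on. It is a version of the conditional expectation of \<open>f\<close> given those
  coordinates, and it is given by the same explicit formula for all solutions.

  Transitivity is proved without couplings and without conditional distributions. As \<open>n\<close> grows,
  the functions \<open>avg n f\<close> form a reverse martingale, hence converge in \<open>L\<^sup>2\<close> to a tail
  function. Under an extreme solution \<open>P\<close> every bounded tail function is almost surely constant:
  otherwise it would give two tail-measurable densities that split \<open>P\<close> into two other solutions. So
  \<open>avg n f\<close> is close to \<open>P(f)\<close> at most points when \<open>n\<close> is large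
  (\<open>extreme_concentration\<close>). For two extreme solutions \<open>P\<close> and \<open>Q\<close> choose points
  \<open>x\<close> and \<open>y\<close> at which this happens at the same level \<open>n\<close>. Averaging commutes with
  left translation by \<open>h\<close> if \<open>h\<^sub>k = \<phi>\<^sub>k(h\<^sub>k\<^sub>+\<^sub>1)\<close> for \<open>k < n\<close>. The
  quotient \<open>y\<^sub>j x\<^sub>j\<inverse>\<close> for \<open>j \<ge> n\<close>, pushed down along the maps
  \<open>\<phi>\<^sub>k\<close>, is such an \<open>h\<close>, so the translate of \<open>P\<close> by \<open>h\<close> is close to
  \<open>Q\<close> (\<open>approximate_translation\<close>). The set of \<open>h\<close> that satisfy finitely many of these
  closed conditions is non-empty, and compactness of the product group yields an \<open>h\<close> that
  satisfies all of them: it lies in \<open>H\<close> and translates \<open>P\<close> exactly to \<open>Q\<close>.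

  That strong solutions are extreme follows because all solutions give the noise the same law, namely
  the product of the \<open>\<mu>\<^sub>k\<close> (\<open>noise_independent\<close>). If a strong solution \<open>P\<close> is a convex
  combination of solutions, these are dominated by \<open>P\<close>; so they satisfy the same almost sure
  relation between events and noise events, and agree with \<open>P\<close>.
\<close>

section \<open>Borel sets of second countable topological spaces\<close>

lemma space_borel_of [simp]: "space (borel_of T) = topspace T"
  by (simp add: borel_of_def space_measure_of_conv)

lemma sets_borel_of: "sets (borel_of T) = sigma_sets (topspace T) {U. openin T U}"
  unfolding borel_of_def by (rule sets_measure_of) (auto dest: openin_subset)

lemma openin_sets_borel_of [intro]: "openin T U \<Longrightarrow> U \<in> sets (borel_of T)"
  unfolding sets_borel_of by (rule sigma_sets.Basic) simp

lemma sets_borel_of_subset: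
  assumes "\<And>U. openin T U \<Longrightarrow> U \<in> sets N" "space N = topspace T"
  shows "sets (borel_of T) \<subseteq> sets N"
  unfolding sets_borel_of using assms by (metis mem_Collect_eq sets.sigma_sets_subset subsetI)

lemma measurable_borel_of_if_open:
  assumes "f \<in> space M \<rightarrow> topspace T"
    and "\<And>U. openin T U \<Longrightarrow> f -` U \<inter> space M \<in> sets M"
  shows "f \<in> measurable M (borel_of T)"
  unfolding borel_of_def
  by (rule measurable_measure_of) (use assms in \<open>auto dest: openin_subset\<close>)

lemma continuous_map_measurable_borel_of:
  assumes "continuous_map S T f"
  shows "f \<in> measurable (borel_of S) (borel_of T)"
proof (rule measurable_borel_of_if_open)
  show "f \<in> space (borel_of S) \<rightarrow> topspace T"
    using assms by (simp add: continuous_map_def)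
  show "f -` U \<inter> space (borel_of S) \<in> sets (borel_of S)" if "openin T U" for U
    using openin_continuous_map_preimage[OF assms that]
    by (simp add: openin_sets_borel_of vimage_def Int_def conj_commute)
qed

lemma continuous_map_real_measurable_borel_of:
  fixes f :: "'a \<Rightarrow> real"
  assumes "continuous_map S euclideanreal f"
  shows "f \<in> borel_measurable (borel_of S)"
proof (rule borel_measurableI)
  fix U :: "real set" assume "open U"
  then have "openin S {x \<in> topspace S. f x \<in> U}"
    using openin_continuous_map_preimage[OF assms, of U] by simp
  then show "f -` U \<inter> space (borel_of S) \<in> sets (borel_of S)"
    by (simp add: openin_sets_borel_of vimage_def Int_def conj_commute)
qed

text \<open>
  Group multiplication is continuous, hence Borel, for the product topology, but measurability
  arguments with pairs use the product \<open>\<sigma>\<close>-algebra. The two agree because an open set is a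
  union of countably many boxes.
\<close>

lemma second_countable_prod_borel_of:
  assumes "second_countable S" "second_countable T"
  shows "sets (borel_of (prod_topology S T)) \<subseteq> sets (borel_of S \<Otimes>\<^sub>M borel_of T)"
proof (rule sets_borel_of_subset)
  obtain A where A: "countable A" "\<And>V. V \<in> A \<Longrightarrow> openin S V"
    "\<And>U x. openin S U \<Longrightarrow> x \<in> U \<Longrightarrow> \<exists>V\<in>A. x \<in> V \<and> V \<subseteq> U"
    using assms(1) unfolding second_countable_def by metis
  obtain B where B: "countable B" "\<And>V. V \<in> B \<Longrightarrow> openin T V"
    "\<And>U x. openin T U \<Longrightarrow> x \<in> U \<Longrightarrow> \<exists>V\<in>B. x \<in> V \<and> V \<subseteq> U"
    using assms(2) unfolding second_countable_def by metis
  fix U assume U: "openin (prod_topology S T) U"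
  let ?I = "{p \<in> A \<times> B. fst p \<times> snd p \<subseteq> U}"
  have "U = (\<Union>p\<in>?I. fst p \<times> snd p)"
  proof (intro equalityI subsetI)
    fix z assume "z \<in> U"
    then obtain C D where CD: "openin S C" "openin T D" "fst z \<in> C" "snd z \<in> D" "C \<times> D \<subseteq> U"
      using U unfolding openin_prod_topology_alt by (metis prod.collapse)
    obtain V W where "V \<in> A" "fst z \<in> V" "V \<subseteq> C" "W \<in> B" "snd z \<in> W" "W \<subseteq> D"
      using A(3)[OF CD(1,3)] B(3)[OF CD(2,4)] by auto
    then show "z \<in> (\<Union>p\<in>?I. fst p \<times> snd p)"
      using CD by (intro UN_I[of "(V, W)"]) (auto simp: mem_Times_iff)
  qed auto
  moreover have "(\<Union>p\<in>?I. fst p \<times> snd p) \<in> sets (borel_of S \<Otimes>\<^sub>M borel_of T)"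
  proof (rule sets.countable_UN'')
    show "countable ?I"
      by (rule countable_subset[of _ "A \<times> B"]) (use A B in auto)
    show "fst p \<times> snd p \<in> sets (borel_of S \<Otimes>\<^sub>M borel_of T)" if p: "p \<in> ?I" for p
      using A(2)[of "fst p"] B(2)[of "snd p"] p by (intro pair_measureI openin_sets_borel_of) auto
  qed
  ultimately show "U \<in> sets (borel_of S \<Otimes>\<^sub>M borel_of T)"
    by simp
qed (simp add: space_pair_measure)

text \<open>
  The base consists of the finite intersections of preimages, under the coordinate maps, of sets from
  countable bases of the factors. Its members are also measurable for the product
  \<open>\<sigma>\<close>-algebra, which identifies the Borel \<open>\<sigma>\<close>-algebra of the product below.
\<close>

lemma second_countable_product_topology_nat:
  fixes T :: "nat \<Rightarrow> 'a topology"
  assumes "\<And>i. second_countable (T i)"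
  shows "\<exists>\<B>. countable \<B> \<and>
    (\<forall>V\<in>\<B>. openin (product_topology T UNIV) V \<and> V \<in> sets (PiM UNIV (\<lambda>i. borel_of (T i)))) \<and>
    (\<forall>U x. openin (product_topology T UNIV) U \<and> x \<in> U \<longrightarrow> (\<exists>V\<in>\<B>. x \<in> V \<and> V \<subseteq> U))"
proof -
  let ?X = "product_topology T UNIV"
  have "\<forall>i. \<exists>B. countable B \<and> (\<forall>V\<in>B. openin (T i) V) \<and>
      (\<forall>U x. openin (T i) U \<and> x \<in> U \<longrightarrow> (\<exists>V\<in>B. x \<in> V \<and> V \<subseteq> U))"
    using assms unfolding second_countable_def by blast
  then obtain B where B: "\<And>i. countable (B i)" "\<And>i V. V \<in> B i \<Longrightarrow> openin (T i) V"
    "\<And>i U x. openin (T i) U \<Longrightarrow> x \<in> U \<Longrightarrow> \<exists>V\<in>B i. x \<in> V \<and> V \<subseteq> U"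
    by metis
  define g where "g p = {x \<in> topspace ?X. x (fst p) \<in> snd p}" for p :: "nat \<times> 'a set"
  define \<G> where "\<G> = g ` (SIGMA i:UNIV. B i)"
  define \<B> where "\<B> = (\<lambda>F. topspace ?X \<inter> \<Inter>F) ` {F. finite F \<and> F \<subseteq> \<G>}"
  have "countable \<G>"
    unfolding \<G>_def using B(1) by (intro countable_image countable_SIGMA) auto
  then have 1: "countable \<B>"
    unfolding \<B>_def using countable_Collect_finite_subset[of \<G>]
    by (simp add: conj_commute)
  have openg: "openin ?X W" if WG: "W \<in> \<G>" for W
  proof -
    obtain i V where W: "W = g (i, V)" "V \<in> B i"
      using WG unfolding \<G>_def by blast
    show ?thesis
      unfolding W g_def fst_conv snd_conv
      using openin_continuous_map_preimage[OF continuous_map_product_projection[of i UNIV T] B(2)[OF W(2)]] by simp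
  qed
  have measg: "W \<in> sets (PiM UNIV (\<lambda>i. borel_of (T i)))" if WG: "W \<in> \<G>" for W
  proof -
    obtain i V where W: "W = g (i, V)" "V \<in> B i"
      using WG unfolding \<G>_def by blast
    have "(\<lambda>x. x i) -` V \<inter> space (PiM UNIV (\<lambda>i. borel_of (T i))) \<in> sets (PiM UNIV (\<lambda>i. borel_of (T i)))"
      using B(2)[OF W(2)] by (intro measurable_sets[OF measurable_component_singleton]) auto
    moreover have "(\<lambda>x. x i) -` V \<inter> space (PiM UNIV (\<lambda>i. borel_of (T i))) = W"
      by (auto simp: W g_def space_PiM)
    ultimately show ?thesis by simp
  qed
  have 2: "openin ?X V" if V: "V \<in> \<B>" for V
  proof -
    obtain F where F: "V = topspace ?X \<inter> \<Inter>F" "finite F" "F \<subseteq> \<G>"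
      using V by (auto simp: \<B>_def)
    have "openin ?X (\<Inter>(insert (topspace ?X) F))"
      using F openg by (intro openin_Inter) (auto simp del: topspace_product_topology)
    then show ?thesis by (simp add: F)
  qed
  have 3: "V \<in> sets (PiM UNIV (\<lambda>i. borel_of (T i)))" if V: "V \<in> \<B>" for V
  proof -
    obtain F where F: "V = topspace ?X \<inter> \<Inter>F" "finite F" "F \<subseteq> \<G>"
      using V by (auto simp: \<B>_def)
    have top: "topspace ?X \<in> sets (PiM UNIV (\<lambda>i. borel_of (T i)))"
      using sets.top[of "PiM UNIV (\<lambda>i. borel_of (T i))"] by (simp add: space_PiM)
    have "(\<Inter>W\<in>insert (topspace ?X) F. W) \<in> sets (PiM UNIV (\<lambda>i. borel_of (T i)))"
      using F measg top by (intro sets.finite_INT) (auto simp del: topspace_product_topology)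
    then show ?thesis by (simp add: F)
  qed
  have 4: "\<exists>V\<in>\<B>. x \<in> V \<and> V \<subseteq> U" if U: "openin ?X U" "x \<in> U" for U x
  proof -
    have "\<forall>x\<in>U. \<exists>W. finite {i \<in> UNIV. W i \<noteq> topspace (T i)} \<and>
        (\<forall>i\<in>UNIV. openin (T i) (W i)) \<and> x \<in> Pi\<^sub>E UNIV W \<and> Pi\<^sub>E UNIV W \<subseteq> U"
      using U(1) by (simp only: openin_product_topology_alt)
    then obtain W where W0: "finite {i \<in> UNIV. W i \<noteq> topspace (T i)} \<and> (\<forall>i\<in>UNIV. openin (T i) (W i)) \<and>
        x \<in> Pi\<^sub>E UNIV W \<and> Pi\<^sub>E UNIV W \<subseteq> U"
      using U(2) by blast
    then have W: "finite {i. W i \<noteq> topspace (T i)}" "\<And>i. openin (T i) (W i)"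
      "x \<in> Pi\<^sub>E UNIV W" "Pi\<^sub>E UNIV W \<subseteq> U"
      by simp_all
    have "\<forall>i. \<exists>V. V \<in> B i \<and> x i \<in> V \<and> V \<subseteq> W i"
    proof
      fix i
      have "x i \<in> W i" using W(3) by auto
      from B(3)[OF W(2) this] show "\<exists>V. V \<in> B i \<and> x i \<in> V \<and> V \<subseteq> W i" by auto
    qed
    from choice[OF this] obtain V where V: "\<forall>i. V i \<in> B i \<and> x i \<in> V i \<and> V i \<subseteq> W i"
      by (elim exE)
    let ?F = "(\<lambda>i. g (i, V i)) ` {i. W i \<noteq> topspace (T i)}"
    have "topspace ?X \<inter> \<Inter>?F \<in> \<B>"
      unfolding \<B>_def \<G>_def using W(1) V by (intro imageI) auto
    moreover have "x \<in> topspace ?X"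
      using U openin_subset by blast
    then have "x \<in> topspace ?X \<inter> \<Inter>?F"
      using V by (auto simp: g_def)
    moreover have "topspace ?X \<inter> \<Inter>?F \<subseteq> Pi\<^sub>E UNIV W"
    proof
      fix y assume y: "y \<in> topspace ?X \<inter> \<Inter>?F"
      have "y i \<in> W i" for i
      proof (cases "W i = topspace (T i)")
        case True
        then show ?thesis using y by auto
      next
        case False
        then have "y i \<in> V i" using y by (simp add: g_def)
        then show ?thesis using V by blast
      qed
      then show "y \<in> Pi\<^sub>E UNIV W" by auto
    qed
    ultimately show ?thesis using W(4) by (intro bexI[of _ "topspace ?X \<inter> \<Inter>?F"] conjI) auto
  qed
  show ?thesis
  proof (intro exI[of _ \<B>] conjI ballI allI impI)
    show "\<exists>V\<in>\<B>. x \<in> V \<and> V \<subseteq> U" if U: "openin ?X U \<and> x \<in> U" for U x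
      using 4 U by simp
  qed (use 1 2 3 in simp_all)
qed

lemma openin_eq_countable_Union_base:
  assumes "countable \<B>" "\<And>V. V \<in> \<B> \<Longrightarrow> openin X V"
    "\<And>U x. openin X U \<Longrightarrow> x \<in> U \<Longrightarrow> \<exists>V\<in>\<B>. x \<in> V \<and> V \<subseteq> U" "openin X U"
  shows "U = \<Union>{V \<in> \<B>. V \<subseteq> U}"
  using assms by blast

lemma sets_borel_of_product:
  fixes T :: "nat \<Rightarrow> 'a topology"
  assumes "\<And>i. second_countable (T i)"
  shows "sets (borel_of (product_topology T UNIV)) = sets (PiM UNIV (\<lambda>i. borel_of (T i)))"
proof
  let ?X = "product_topology T UNIV"
  obtain \<B> where B0: "countable \<B> \<and>
    (\<forall>V\<in>\<B>. openin ?X V \<and> V \<in> sets (PiM UNIV (\<lambda>i. borel_of (T i)))) \<and>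
    (\<forall>U x. openin ?X U \<and> x \<in> U \<longrightarrow> (\<exists>V\<in>\<B>. x \<in> V \<and> V \<subseteq> U))"
    using second_countable_product_topology_nat[of T, OF assms] by (rule exE)
  then have B: "countable \<B>" "\<And>V. V \<in> \<B> \<Longrightarrow> openin ?X V"
    "\<And>V. V \<in> \<B> \<Longrightarrow> V \<in> sets (PiM UNIV (\<lambda>i. borel_of (T i)))"
    "\<And>U x. openin ?X U \<Longrightarrow> x \<in> U \<Longrightarrow> \<exists>V\<in>\<B>. x \<in> V \<and> V \<subseteq> U"
    by simp_all
  show "sets (borel_of ?X) \<subseteq> sets (PiM UNIV (\<lambda>i. borel_of (T i)))"
  proof (rule sets_borel_of_subset)
    fix U assume "openin ?X U"
    then have "U = \<Union>{V \<in> \<B>. V \<subseteq> U}"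
      using B(1,2,4) by (intro openin_eq_countable_Union_base[of \<B> ?X]) simp_all
    also have "\<dots> \<in> sets (PiM UNIV (\<lambda>i. borel_of (T i)))"
      using B by (intro sets.countable_Union) auto
    finally show "U \<in> sets (PiM UNIV (\<lambda>i. borel_of (T i)))" .
  qed (simp add: space_PiM)
  have "(\<lambda>x. x) \<in> measurable (borel_of ?X) (PiM UNIV (\<lambda>i. borel_of (T i)))"
  proof (rule measurable_PiM_single')
    fix i :: nat
    show "(\<lambda>x. x i) \<in> measurable (borel_of ?X) (borel_of (T i))"
      by (intro continuous_map_measurable_borel_of continuous_map_product_projection) simp
  qed auto
  from measurable_sets[OF this]
  have "A \<inter> topspace ?X \<in> sets (borel_of ?X)" if "A \<in> sets (PiM UNIV (\<lambda>i. borel_of (T i)))" for A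
    using that by simp
  moreover have "A \<inter> topspace ?X = A" if "A \<in> sets (PiM UNIV (\<lambda>i. borel_of (T i)))" for A
    using sets.sets_into_space[OF that] by (auto simp: space_PiM)
  ultimately show "sets (PiM UNIV (\<lambda>i. borel_of (T i))) \<subseteq> sets (borel_of ?X)"
    by (intro subsetI) simp
qed

text \<open>
  The indicator of an open set is a pointwise limit of continuous functions: exhaust the set by an
  increasing sequence of closed sets, taken from the closures of base sets by regularity, and
  separate each of these from the complement by Urysohn's lemma.
\<close>

lemma measure_eqI_continuous_integrals:
  fixes P Q :: "'a measure"
  assumes X: "compact_space X" "Hausdorff_space X" "second_countable X"
    and P: "borel_prob_measure X P" and Q: "borel_prob_measure X Q"
    and eq: "\<And>f. continuous_map X euclideanreal f \<Longrightarrow> (\<integral>x. f x \<partial>P) = (\<integral>x. f x \<partial>Q)"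
  shows "P = Q"
proof -
  interpret P: prob_space P using P by (simp add: borel_prob_measure_def)
  interpret Q: prob_space Q using Q by (simp add: borel_prob_measure_def)
  have sP [measurable_cong]: "sets P = sets (borel_of X)" and sQ [measurable_cong]: "sets Q = sets (borel_of X)"
    using P Q by (auto simp: borel_prob_measure_def)
  have spP: "space P = topspace X" and spQ: "space Q = topspace X"
    using sets_eq_imp_space_eq[OF sP] sets_eq_imp_space_eq[OF sQ] by auto
  have norm: "normal_space X" and reg: "regular_space X"
    using X compact_Hausdorff_or_regular_imp_normal_space compact_Hausdorff_imp_regular_space by blast+
  obtain \<B> where B: "countable \<B>" "\<And>V. V \<in> \<B> \<Longrightarrow> openin X V"
    "\<And>U x. openin X U \<Longrightarrow> x \<in> U \<Longrightarrow> \<exists>V\<in>\<B>. x \<in> V \<and> V \<subseteq> U"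
    using X(3) unfolding second_countable_def by metis
  have key: "emeasure P U = emeasure Q U" if U: "openin X U" for U
  proof -
    \<comment> \<open>The empty set is added because enumerating a countable set needs an element.\<close>
    let ?D = "insert {} {V \<in> \<B>. X closure_of V \<subseteq> U}"
    have cD: "countable ?D" using B(1) by simp
    let ?V = "from_nat_into ?D"
    define C where "C n = (\<Union>i\<le>n. X closure_of (?V i))" for n :: nat
    have VD: "?V i \<in> ?D" for i
      using from_nat_into[of ?D i] by blast
    have clC: "closedin X (C n)" for n
      unfolding C_def by (intro closedin_Union) auto
    have CU: "C n \<subseteq> U" for n
    proof
      fix x assume "x \<in> C n"
      then obtain i where "x \<in> X closure_of ?V i" by (auto simp: C_def)
      then show "x \<in> U" using VD[of i] by (elim insertE CollectE) auto
    qed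
    have UC: "\<exists>n. x \<in> C n" if x: "x \<in> U" for x
    proof -
      have "neighbourhood_base_of (closedin X) X"
        using reg by (simp add: neighbourhood_base_of_closedin)
      then obtain W K where W: "openin X W" "closedin X K" "x \<in> W" "W \<subseteq> K" "K \<subseteq> U"
        using U x neighbourhood_base_of[of "closedin X" X] by metis
      then obtain V where V: "V \<in> \<B>" "x \<in> V" "V \<subseteq> W" using B(3)[OF W(1,3)] by blast
      have "X closure_of V \<subseteq> K" using V W by (intro closure_of_minimal) auto
      then have "V \<in> ?D" using V W by auto
      then obtain n where n: "?V n = V"
        using from_nat_into_surj[OF cD, of V] by blast
      have "x \<in> X closure_of V"
        using V(2) closure_of_subset[OF openin_subset[OF B(2)[OF V(1)]]] by blast
      then show ?thesis using n unfolding C_def by blast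
    qed
    have "\<forall>n. \<exists>f. continuous_map X (top_of_set {0..1::real}) f \<and>
        f ` (topspace X - U) \<subseteq> {0} \<and> f ` C n \<subseteq> {1}"
    proof
      fix n
      have disj: "disjnt (topspace X - U) (C n)" using CU[of n] by (auto simp: disjnt_def)
      have clU: "closedin X (topspace X - U)" using U by (rule closedin_diff[OF closedin_topspace])
      obtain f where "continuous_map X (top_of_set {0..1::real}) f"
        "f ` (topspace X - U) \<subseteq> {0}" "f ` C n \<subseteq> {1}"
        by (rule Urysohn_lemma[OF norm clU clC[of n] disj, of 0 1]) simp
      then show "\<exists>f. continuous_map X (top_of_set {0..1::real}) f \<and>
          f ` (topspace X - U) \<subseteq> {0} \<and> f ` C n \<subseteq> {1}"
        by (intro exI[of _ f]) simp
    qed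
    from choice[OF this] obtain f where "\<forall>n. continuous_map X (top_of_set {0..1::real}) (f n) \<and>
        f n ` (topspace X - U) \<subseteq> {0} \<and> f n ` C n \<subseteq> {1}"
      by (elim exE)
    then have f: "\<And>n. continuous_map X (top_of_set {0..1::real}) (f n)"
      "\<And>n. f n ` (topspace X - U) \<subseteq> {0}" "\<And>n. f n ` C n \<subseteq> {1}"
      by blast+
    have fc: "continuous_map X euclideanreal (f n)" and f01: "x \<in> topspace X \<Longrightarrow> f n x \<in> {0..1}" for n x
      using f(1)[of n] by (auto simp: continuous_map_in_subtopology)
    have fm [measurable]: "f n \<in> borel_measurable (borel_of X)" for n
      using fc by (rule continuous_map_real_measurable_borel_of)
    have lim: "(\<lambda>n. f n x) \<longlonglongrightarrow> indicator U x" if x: "x \<in> topspace X" for x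
    proof (cases "x \<in> U")
      case True
      then obtain m where m: "x \<in> C m" using UC by blast
      have "\<forall>\<^sub>F n in sequentially. f n x = 1"
        unfolding eventually_sequentially
      proof (intro exI[of _ m] allI impI)
        fix n assume "m \<le> n"
        then have "x \<in> C n" using m by (auto simp: C_def)
        then show "f n x = 1" using f(3) by blast
      qed
      then show ?thesis using True by (simp add: tendsto_eventually)
    next
      case False
      then have "f n x = 0" for n using f(2)[of n] x by blast
      then show ?thesis using False by simp
    qed
    have Us: "U \<in> sets (borel_of X)" using U by blast
    have "(\<lambda>n. \<integral>x. f n x \<partial>P) \<longlonglongrightarrow> (\<integral>x. indicator U x \<partial>P)"
      using lim f01 Us
      by (intro integral_dominated_convergence[where w="\<lambda>_. 1"]) (auto simp: spP intro!: AE_I2)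
    moreover have "(\<lambda>n. \<integral>x. f n x \<partial>Q) \<longlonglongrightarrow> (\<integral>x. indicator U x \<partial>Q)"
      using lim f01 Us
      by (intro integral_dominated_convergence[where w="\<lambda>_. 1"]) (auto simp: spQ intro!: AE_I2)
    ultimately have "(\<integral>x. indicator U x \<partial>P) = (\<integral>x. indicator U x \<partial>Q :: real)"
      using LIMSEQ_unique eq[OF fc] by simp
    then show ?thesis
      using Us sP sQ by (simp add: P.emeasure_eq_measure Q.emeasure_eq_measure)
  qed
  show ?thesis
  proof (rule measure_eqI_generator_eq[of "{U. openin X U}" "topspace X" P Q "\<lambda>_. topspace X"])
    show "Int_stable {U. openin X U}" by (auto simp: Int_stable_def)
  qed (auto simp: key sP sQ sets_borel_of dest: openin_subset)
qed

section \<open>Extreme measures and mean square convergence\<close>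

lemma extreme_measuresD:
  assumes "P \<in> extreme_measures \<P>" "Q \<in> \<P>" "R \<in> \<P>" "0 < t" "t < (1::real)"
    and "\<And>A. A \<in> sets P \<Longrightarrow> measure P A = t * measure Q A + (1 - t) * measure R A"
  shows "Q = P"
  using assms unfolding extreme_measures_def by auto

text \<open>
  Along a subsequence whose consecutive differences have second moments below \<open>4\<^sup>-\<^sup>j\<close>, the
  first absolute moments of these differences are summable, so the differences are almost surely
  absolutely summable.
\<close>

lemma (in prob_space) L2_Cauchy_imp_AE_convergent_subseq:
  fixes u :: "nat \<Rightarrow> 'a \<Rightarrow> real"
  assumes u [measurable]: "\<And>n. u n \<in> borel_measurable M"
    and int: "\<And>m n. integrable M (\<lambda>x. (u m x - u n x)\<^sup>2)"
    and Cauchy: "\<And>e. 0 < e \<Longrightarrow> \<exists>N. \<forall>m\<ge>N. \<forall>n\<ge>N. (\<integral>x. (u m x - u n x)\<^sup>2 \<partial>M) < e"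
  shows "\<exists>r. strict_mono r \<and> (AE x in M. convergent (\<lambda>j. u (r j) x))"
proof -
  obtain N where "\<forall>j. (\<forall>m\<ge>N j. \<forall>n\<ge>N j. (\<integral>x. (u m x - u n x)\<^sup>2 \<partial>M) < (1/4)^j)"
    using choice[of "\<lambda>j N. \<forall>m\<ge>N. \<forall>n\<ge>N. (\<integral>x. (u m x - u n x)\<^sup>2 \<partial>M) < (1/4)^j"] Cauchy by auto
  then have N: "\<And>j m n. N j \<le> m \<Longrightarrow> N j \<le> n \<Longrightarrow> (\<integral>x. (u m x - u n x)\<^sup>2 \<partial>M) < (1/4)^j"
    by simp
  define r where "r = rec_nat (N 0) (\<lambda>j k. Suc (max k (N (Suc j))))"
  have r: "N j \<le> r j" "r j < r (Suc j)" for j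
    by (cases j) (auto simp: r_def)
  have mono: "strict_mono r" using r(2) by (simp add: strict_mono_Suc_iff)
  define d where "d j x = u (r (Suc j)) x - u (r j) x" for j x
  have dm [measurable]: "d j \<in> borel_measurable M" for j unfolding d_def by measurable
  have d2: "integrable M (\<lambda>x. (d j x)\<^sup>2)" "(\<integral>x. (d j x)\<^sup>2 \<partial>M) \<le> (1/4)^j" for j
    unfolding d_def using int N[of j "r (Suc j)" "r j"] r[of j] by (auto intro: less_imp_le)
  \<comment> \<open>The weight \<open>2\<^sup>j\<close> balances the bound \<open>4\<^sup>-\<^sup>j\<close> on the second moment against the constant \<open>2\<^sup>-\<^sup>j\<close>.\<close>
  have amgm: "\<bar>d j x\<bar> \<le> (2^j * (d j x)\<^sup>2 + (1/2)^j) / 2" for j x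
  proof -
    have "0 \<le> (2^j * \<bar>d j x\<bar> - 1)\<^sup>2" by simp
    then have "2 * (2^j * \<bar>d j x\<bar>) \<le> (2^j)\<^sup>2 * (d j x)\<^sup>2 + 1"
      by (simp add: power2_diff power_mult_distrib)
    then have "(1/2)^j * (2 * (2^j * \<bar>d j x\<bar>)) \<le> (1/2)^j * ((2^j)\<^sup>2 * (d j x)\<^sup>2 + 1)"
      by (intro mult_left_mono) auto
    also have "(1/2)^j * (2 * (2^j * \<bar>d j x\<bar>)) = 2 * \<bar>d j x\<bar>"
      by (simp add: power_divide)
    also have "(1/2)^j * ((2^j)\<^sup>2 * (d j x)\<^sup>2 + 1) = 2^j * (d j x)\<^sup>2 + (1/2)^j"
      by (simp add: power_divide power2_eq_square field_simps)
    finally show ?thesis by simp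
  qed
  have nn: "(\<integral>\<^sup>+x. ennreal \<bar>d j x\<bar> \<partial>M) \<le> ennreal ((1/2)^j)" for j
  proof -
    have i: "integrable M (\<lambda>x. (2^j * (d j x)\<^sup>2 + (1/2)^j) / 2)"
      using d2(1) by simp
    have "(\<integral>\<^sup>+x. ennreal \<bar>d j x\<bar> \<partial>M) \<le> (\<integral>\<^sup>+x. ennreal ((2^j * (d j x)\<^sup>2 + (1/2)^j) / 2) \<partial>M)"
      by (intro nn_integral_mono ennreal_leI amgm)
    also have "\<dots> = ennreal (\<integral>x. (2^j * (d j x)\<^sup>2 + (1/2)^j) / 2 \<partial>M)"
      by (rule nn_integral_eq_integral[OF i]) simp
    also have "(\<integral>x. (2^j * (d j x)\<^sup>2 + (1/2)^j) / 2 \<partial>M) = (2^j * (\<integral>x. (d j x)\<^sup>2 \<partial>M) + (1/2)^j) / 2"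
      using d2(1) by (simp add: prob_space)
    also have "\<dots> \<le> (2^j * (1/4)^j + (1/2)^j) / 2"
      by (intro divide_right_mono add_right_mono mult_left_mono d2(2)) simp_all
    also have "(2::real)^j * (1/4)^j = (1/2)^j"
      by (subst power_mult_distrib[symmetric]) simp
    also have "((1/2)^j + (1/2)^j) / 2 = ((1/2)^j :: real)"
      by simp
    finally show ?thesis by (simp add: ennreal_leI)
  qed
  have "(\<integral>\<^sup>+x. (\<Sum>j. ennreal \<bar>d j x\<bar>) \<partial>M) = (\<Sum>j. \<integral>\<^sup>+x. ennreal \<bar>d j x\<bar> \<partial>M)"
    by (rule nn_integral_suminf) simp
  also have "\<dots> \<le> (\<Sum>j. ennreal ((1/2)^j))"
    by (intro suminf_le nn) auto
  also have "\<dots> = ennreal (\<Sum>j. (1/2)^j)"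
    by (rule suminf_ennreal2) (simp_all add: summable_geometric)
  also have "\<dots> < \<infinity>" by simp
  finally have "(\<integral>\<^sup>+x. (\<Sum>j. ennreal \<bar>d j x\<bar>) \<partial>M) \<noteq> \<infinity>"
    by simp
  then have "AE x in M. (\<Sum>j. ennreal \<bar>d j x\<bar>) \<noteq> \<infinity>"
    by (intro nn_integral_PInf_AE) auto
  then have "AE x in M. convergent (\<lambda>j. u (r j) x)"
  proof eventually_elim
    case (elim x)
    then have "summable (\<lambda>j. \<bar>d j x\<bar>)"
      by (intro summable_suminf_not_top) auto
    then have "summable (\<lambda>j. d j x)" by (rule summable_rabs_cancel)
    then have "summable (\<lambda>j. u (r (Suc j)) x - u (r j) x)" by (simp add: d_def)
    then have "convergent (\<lambda>n. (\<Sum>j<n. u (r (Suc j)) x - u (r j) x) + u (r 0) x)"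
      by (intro convergent_add convergent_const) (simp add: summable_iff_convergent)
    moreover have "(\<Sum>j<n. u (r (Suc j)) x - u (r j) x) + u (r 0) x = u (r n) x" for n
      using sum_lessThan_telescope[of "\<lambda>k. u (r k) x" n] by simp
    ultimately show ?case by simp
  qed
  then show ?thesis using mono by (intro exI[of _ r]) simp
qed

section \<open>The product of a chain of compact groups\<close>

definition resample ::
  "(nat \<Rightarrow> ('a, 'b) monoid_scheme) \<Rightarrow> (nat \<Rightarrow> 'a \<Rightarrow> 'a) \<Rightarrow> nat \<Rightarrow> (nat \<Rightarrow> 'a) \<Rightarrow> 'a \<Rightarrow> nat \<Rightarrow> 'a" where
  "resample G \<phi> k x z = x(k := \<phi> k (x (Suc k)) \<otimes>\<^bsub>G k\<^esub> z)"

locale compact_group_chain =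
  fixes G :: "nat \<Rightarrow> ('a, 'b) monoid_scheme"
    and T :: "nat \<Rightarrow> 'a topology"
    and \<phi> :: "nat \<Rightarrow> 'a \<Rightarrow> 'a"
    and \<mu> :: "nat \<Rightarrow> 'a measure"
  assumes topgroup: "\<And>k. topological_group (G k) (T k)"
    and compact: "\<And>k. compact_space (T k)"
    and Hausdorff: "\<And>k. Hausdorff_space (T k)"
    and second_countable: "\<And>k. second_countable (T k)"
    and hom: "\<And>k. \<phi> k \<in> hom (G (Suc k)) (G k)"
    and continuous_phi: "\<And>k. continuous_map (T (Suc k)) (T k) (\<phi> k)"
    and prob_mu: "\<And>k. borel_prob_measure (T k) (\<mu> k)"
begin

text \<open>
  The product space is a constant of its own: if it were an abbreviation, simplification would turn
  membership into a statement about all coordinates.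
\<close>

definition \<Omega> :: "(nat \<Rightarrow> 'a) set" where
  "\<Omega> = (\<Pi>\<^sub>E k\<in>UNIV. carrier (G k))"

lemma PiE_carrier [simp]: "(\<Pi>\<^sub>E k\<in>UNIV. carrier (G k)) = \<Omega>"
  by (simp add: \<Omega>_def)

abbreviation X :: "(nat \<Rightarrow> 'a) topology" where
  "X \<equiv> product_topology T UNIV"

abbreviation S :: "(nat \<Rightarrow> 'a) measure" where
  "S \<equiv> PiM UNIV (\<lambda>k. borel_of (T k))"

lemma group_G [simp, intro]: "group (G k)"
  and topspace_T [simp]: "topspace (T k) = carrier (G k)"
  and continuous_mult: "continuous_map (prod_topology (T k) (T k)) (T k) (\<lambda>(x, y). x \<otimes>\<^bsub>G k\<^esub> y)"
  and continuous_inv: "continuous_map (T k) (T k) (\<lambda>x. inv\<^bsub>G k\<^esub> x)"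
  using topgroup[of k] by (auto simp: topological_group_def)

lemma group_hom_phi: "group_hom (G (Suc k)) (G k) (\<phi> k)"
  by (intro group_hom.intro group_hom_axioms.intro hom group_G)

lemma G_closed [simp, intro]:
  "x \<in> carrier (G k) \<Longrightarrow> y \<in> carrier (G k) \<Longrightarrow> x \<otimes>\<^bsub>G k\<^esub> y \<in> carrier (G k)"
  "x \<in> carrier (G k) \<Longrightarrow> inv\<^bsub>G k\<^esub> x \<in> carrier (G k)"
  "\<one>\<^bsub>G k\<^esub> \<in> carrier (G k)"
  by (simp_all add: group.is_monoid monoid.m_closed group.inv_closed)

lemma phi_closed [simp, intro]: "x \<in> carrier (G (Suc k)) \<Longrightarrow> \<phi> k x \<in> carrier (G k)"
  using hom[of k] by (auto simp: hom_def)

lemma phi_mult: "x \<in> carrier (G (Suc k)) \<Longrightarrow> y \<in> carrier (G (Suc k)) \<Longrightarrow>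
    \<phi> k (x \<otimes>\<^bsub>G (Suc k)\<^esub> y) = \<phi> k x \<otimes>\<^bsub>G k\<^esub> \<phi> k y"
  using hom[of k] by (auto simp: hom_def)

lemma space_S [simp]: "space S = \<Omega>"
  by (simp add: space_PiM)

lemma measurable_component_S: "(\<lambda>x. x k) \<in> measurable S (borel_of (T k))"
  by (rule measurable_component_singleton) simp

lemma topspace_X: "topspace X = \<Omega>"
  by simp

lemma sets_borel_X: "sets (borel_of X) = sets S"
  by (rule sets_borel_of_product) (rule second_countable)

lemma \<Omega>_D [simp]: "x \<in> \<Omega> \<Longrightarrow> x k \<in> carrier (G k)"
  unfolding \<Omega>_def PiE_iff by simp

lemma \<Omega>_I: "(\<And>k. x k \<in> carrier (G k)) \<Longrightarrow> x \<in> \<Omega>"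
  unfolding \<Omega>_def PiE_iff by simp

lemma \<Omega>_iff: "x \<in> \<Omega> \<longleftrightarrow> (\<forall>k. x k \<in> carrier (G k))"
  unfolding \<Omega>_def PiE_iff by simp

lemma measurable_mult [measurable (raw)]:
  assumes [measurable]: "f \<in> measurable N (borel_of (T k))" "g \<in> measurable N (borel_of (T k))"
  shows "(\<lambda>x. f x \<otimes>\<^bsub>G k\<^esub> g x) \<in> measurable N (borel_of (T k))"
proof -
  have "(\<lambda>(x, y). x \<otimes>\<^bsub>G k\<^esub> y) \<in> measurable (borel_of (prod_topology (T k) (T k))) (borel_of (T k))"
    by (intro continuous_map_measurable_borel_of continuous_mult)
  then have "(\<lambda>(x, y). x \<otimes>\<^bsub>G k\<^esub> y) \<in> measurable (borel_of (T k) \<Otimes>\<^sub>M borel_of (T k)) (borel_of (T k))"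
    using second_countable_prod_borel_of[OF second_countable[of k] second_countable[of k]]
    by (auto simp: measurable_def space_pair_measure)
  from measurable_compose[OF measurable_Pair[OF assms] this]
  show ?thesis by simp
qed

lemma measurable_inv [measurable (raw)]:
  assumes "f \<in> measurable N (borel_of (T k))"
  shows "(\<lambda>x. inv\<^bsub>G k\<^esub> (f x)) \<in> measurable N (borel_of (T k))"
  by (rule measurable_compose[OF assms continuous_map_measurable_borel_of[OF continuous_inv]])

lemma measurable_phi [measurable (raw)]:
  assumes "f \<in> measurable N (borel_of (T (Suc k)))"
  shows "(\<lambda>x. \<phi> k (f x)) \<in> measurable N (borel_of (T k))"
  by (rule measurable_compose[OF assms continuous_map_measurable_borel_of[OF continuous_phi]])

lemma sets_mu [measurable_cong]: "sets (\<mu> k) = sets (borel_of (T k))"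
  and prob_space_mu: "prob_space (\<mu> k)"
  using prob_mu[of k] by (auto simp: borel_prob_measure_def)

lemma space_mu [simp]: "space (\<mu> k) = carrier (G k)"
  using sets_eq_imp_space_eq[OF sets_mu[of k]] by simp

lemma measurable_S_I:
  assumes "\<And>k. (\<lambda>x. f x k) \<in> measurable N (borel_of (T k))"
  shows "f \<in> measurable N S"
proof (rule measurable_PiM_single')
  show "f \<in> space N \<rightarrow> (\<Pi>\<^sub>E i\<in>UNIV. space (borel_of (T i)))"
    using measurable_space[OF assms] by (auto simp: \<Omega>_iff)
qed (use assms in auto)

lemma resample_closed [simp, intro]:
  "x \<in> \<Omega> \<Longrightarrow> z \<in> carrier (G k) \<Longrightarrow> resample G \<phi> k x z \<in> \<Omega>"
  by (rule \<Omega>_I) (auto simp: resample_def)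

lemma measurable_resample [measurable (raw)]:
  assumes f [measurable]: "f \<in> measurable N S" and g [measurable]: "g \<in> measurable N (borel_of (T k))"
  shows "(\<lambda>p. resample G \<phi> k (f p) (g p)) \<in> measurable N S"
proof (rule measurable_S_I)
  fix j
  have c [measurable]: "(\<lambda>p. f p i) \<in> measurable N (borel_of (T i))" for i
    using measurable_compose[OF f measurable_component_singleton[of i UNIV]] by simp
  show "(\<lambda>p. resample G \<phi> k (f p) (g p) j) \<in> measurable N (borel_of (T j))"
  proof (cases "j = k")
    case True
    then show ?thesis by (simp add: resample_def)
  qed (simp add: resample_def)
qed

section \<open>Resampling one coordinate\<close>

definition bounded_measurable :: "real \<Rightarrow> ((nat \<Rightarrow> 'a) \<Rightarrow> real) \<Rightarrow> bool" where
  "bounded_measurable c f \<longleftrightarrow> f \<in> borel_measurable S \<and> (\<forall>x\<in>\<Omega>. \<bar>f x\<bar> \<le> c)"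

definition depends_from :: "nat \<Rightarrow> ((nat \<Rightarrow> 'a) \<Rightarrow> 'c) \<Rightarrow> bool" where
  "depends_from n f \<longleftrightarrow> (\<forall>x\<in>\<Omega>. \<forall>y\<in>\<Omega>. (\<forall>j\<ge>n. x j = y j) \<longrightarrow> f x = f y)"

lemma depends_fromI:
  assumes "\<And>x y. x \<in> \<Omega> \<Longrightarrow> y \<in> \<Omega> \<Longrightarrow> (\<And>j. n \<le> j \<Longrightarrow> x j = y j) \<Longrightarrow> f x = f y"
  shows "depends_from n f"
  unfolding depends_from_def
proof (intro ballI impI)
  fix x y assume "x \<in> \<Omega>" "y \<in> \<Omega>" and eq: "\<forall>j\<ge>n. x j = y j"
  then show "f x = f y" by (intro assms) (use eq in simp_all)
qed

lemma depends_fromD: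
  assumes "depends_from n f" "x \<in> \<Omega>" "y \<in> \<Omega>" and eq: "\<And>j. n \<le> j \<Longrightarrow> x j = y j"
  shows "f x = f y"
proof -
  have "\<forall>j\<ge>n. x j = y j" using eq by simp
  with bspec[OF bspec[OF assms(1)[unfolded depends_from_def] assms(2)] assms(3)] show ?thesis
    by (rule mp)
qed

lemma depends_from_mono: "depends_from n f \<Longrightarrow> m \<le> n \<Longrightarrow> depends_from m f"
  by (rule depends_fromI, rule depends_fromD) auto

lemma depends_from_0 [simp]: "depends_from 0 f"
proof (rule depends_fromI)
  fix x y :: "nat \<Rightarrow> 'a" assume "\<And>j. 0 \<le> j \<Longrightarrow> x j = y j"
  then have "x = y" by (intro ext) simp
  then show "f x = f y" by simp
qed

text \<open>
  Resampling integrates out the coordinate \<open>k\<close>: applied to a function of the coordinates from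
  \<open>k\<close> on, it gives the candidate for the conditional expectation given the later ones.
\<close>

definition smooth :: "nat \<Rightarrow> ((nat \<Rightarrow> 'a) \<Rightarrow> real) \<Rightarrow> (nat \<Rightarrow> 'a) \<Rightarrow> real" where
  "smooth k f x = (\<integral>z. f (resample G \<phi> k x z) \<partial>\<mu> k)"

lemma bounded_measurable_smooth:
  assumes "bounded_measurable c f"
  shows "bounded_measurable c (smooth k f)"
  unfolding bounded_measurable_def
proof (intro conjI ballI)
  have [measurable]: "f \<in> borel_measurable S" using assms by (simp add: bounded_measurable_def)
  interpret prob_space "\<mu> k" by (rule prob_space_mu)
  show "smooth k f \<in> borel_measurable S"
    unfolding smooth_def by measurable
  fix x assume x: "x \<in> \<Omega>"
  have b: "\<bar>f (resample G \<phi> k x z)\<bar> \<le> c" if "z \<in> space (\<mu> k)" for z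
    using assms x that unfolding bounded_measurable_def by auto
  have "\<bar>smooth k f x\<bar> \<le> (\<integral>z. \<bar>f (resample G \<phi> k x z)\<bar> \<partial>\<mu> k)"
    unfolding smooth_def by (rule integral_abs_bound)
  also have "\<dots> \<le> (\<integral>z. c \<partial>\<mu> k)"
  proof (rule integral_mono)
    show "integrable (\<mu> k) (\<lambda>z. \<bar>f (resample G \<phi> k x z)\<bar>)"
      using b x by (intro integrable_const_bound[where B=c]) (auto intro!: AE_I2)
  qed (use b in auto)
  finally show "\<bar>smooth k f x\<bar> \<le> c" using prob_space by simp
qed

lemma depends_from_smooth:
  assumes "depends_from k f"
  shows "depends_from (Suc k) (smooth k f)"
  unfolding smooth_def
proof (rule depends_fromI)
  fix x y assume xy: "x \<in> \<Omega>" "y \<in> \<Omega>" "\<And>j. Suc k \<le> j \<Longrightarrow> x j = y j"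
  show "(\<integral>z. f (resample G \<phi> k x z) \<partial>\<mu> k) = (\<integral>z. f (resample G \<phi> k y z) \<partial>\<mu> k)"
  proof (rule Bochner_Integration.integral_cong[OF refl])
    fix z assume "z \<in> space (\<mu> k)"
    then have "resample G \<phi> k x z \<in> \<Omega>" "resample G \<phi> k y z \<in> \<Omega>"
      using xy by auto
    moreover have "resample G \<phi> k x z j = resample G \<phi> k y z j" if "k \<le> j" for j
      using xy(3)[of "Suc k"] xy(3)[of j] that by (simp add: resample_def)
    ultimately show "f (resample G \<phi> k x z) = f (resample G \<phi> k y z)"
      by (rule depends_fromD[OF assms])
  qed
qed

lemma smooth_mult_depends:
  assumes "depends_from (Suc k) w" "x \<in> \<Omega>"
  shows "smooth k (\<lambda>x. w x * f x) x = w x * smooth k f x"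
proof -
  have "smooth k (\<lambda>x. w x * f x) x = (\<integral>z. w x * f (resample G \<phi> k x z) \<partial>\<mu> k)"
    unfolding smooth_def
  proof (rule Bochner_Integration.integral_cong[OF refl])
    fix z assume "z \<in> space (\<mu> k)"
    then have "w (resample G \<phi> k x z) = w x"
      by (intro depends_fromD[OF assms(1)] resample_closed assms(2)) (simp_all add: resample_def)
    then show "w (resample G \<phi> k x z) * f (resample G \<phi> k x z) = w x * f (resample G \<phi> k x z)"
      by simp
  qed
  then show ?thesis by (simp add: smooth_def)
qed

section \<open>The future \<open>\<sigma>\<close>-algebra\<close>

lemma space_future [simp]: "space (future T k) = \<Omega>"
  by (simp add: future_def sigma_gen_by_def space_measure_of_conv)

lemma sets_future: "sets (future T k) =
    sigma_sets \<Omega> (\<Union>i\<in>{k<..}. {(\<lambda>x. x i) -` A \<inter> \<Omega> | A. A \<in> sets (borel_of (T i))})"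
  unfolding future_def sigma_gen_by_def topspace_X by (rule sets_measure_of) auto

lemma measurable_future_component:
  "k < i \<Longrightarrow> (\<lambda>x. x i) \<in> measurable (future T k) (borel_of (T i))"
  by (rule measurableI) (simp, simp only: sets_future space_future, rule sigma_sets.Basic, simp, blast)

lemma sets_future_S: "sets (future T k) \<subseteq> sets S"
proof -
  have "(\<lambda>x. x i) -` A \<inter> \<Omega> \<in> sets S" if "A \<in> sets (borel_of (T i))" for i A
    using measurable_sets[OF measurable_component_singleton[of i UNIV "\<lambda>k. borel_of (T k)"] that] by simp
  then have "sigma_sets (space S) (\<Union>i\<in>{k<..}. {(\<lambda>x. x i) -` A \<inter> \<Omega> | A. A \<in> sets (borel_of (T i))}) \<subseteq> sets S"
    by (intro sets.sigma_sets_subset) auto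
  then show ?thesis by (simp add: sets_future)
qed

lemma depends_from_future:
  assumes "A \<in> sets (future T k)"
  shows "depends_from (Suc k) (\<lambda>x. x \<in> A)"
  using assms unfolding sets_future
proof (induction rule: sigma_sets.induct)
  case (Basic a)
  then obtain i B where i: "k < i" "a = (\<lambda>x. x i) -` B \<inter> \<Omega>" by blast
  show ?case
  proof (rule depends_fromI)
    fix x y assume xy: "x \<in> \<Omega>" "y \<in> \<Omega>" "\<And>j. Suc k \<le> j \<Longrightarrow> x j = y j"
    from i(1) have "x i = y i" by (intro xy(3) Suc_leI)
    with xy(1,2) show "(x \<in> a) = (y \<in> a)" by (simp only: i(2) Int_iff vimage_eq)
  qed
next
  case (Compl a)
  show ?case
  proof (rule depends_fromI)
    fix x y assume xy: "x \<in> \<Omega>" "y \<in> \<Omega>" "\<And>j. Suc k \<le> j \<Longrightarrow> x j = y j"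
    then have "(x \<in> a) = (y \<in> a)" by (rule depends_fromD[OF Compl.IH])
    with xy(1,2) show "(x \<in> \<Omega> - a) = (y \<in> \<Omega> - a)" by (simp only: Diff_iff)
  qed
next
  case (Union a)
  show ?case
  proof (rule depends_fromI)
    fix x y assume xy: "x \<in> \<Omega>" "y \<in> \<Omega>" "\<And>j. Suc k \<le> j \<Longrightarrow> x j = y j"
    have "(x \<in> a i) = (y \<in> a i)" for i
      by (rule depends_fromD[OF Union.IH xy])
    then show "(x \<in> (\<Union>i. a i)) = (y \<in> (\<Union>i. a i))" by simp
  qed
qed (rule depends_fromI, simp)

text \<open>
  Overwriting the first \<open>n\<close> coordinates by \<open>1\<close> realises a function of the later coordinates as
  one that factors through them. This turns measurability and invariance under changes of the first
  \<open>n\<close> coordinates into measurability for the future.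
\<close>

definition reset :: "nat \<Rightarrow> (nat \<Rightarrow> 'a) \<Rightarrow> nat \<Rightarrow> 'a" where
  "reset n x = (\<lambda>j. if j < n then \<one>\<^bsub>G j\<^esub> else x j)"

lemma reset_closed [simp, intro]: "x \<in> \<Omega> \<Longrightarrow> reset n x \<in> \<Omega>"
  by (rule \<Omega>_I) (auto simp: reset_def)

lemma depends_from_reset: "depends_from n f \<Longrightarrow> x \<in> \<Omega> \<Longrightarrow> f (reset n x) = f x"
  by (rule depends_fromD) (simp_all only: reset_closed, simp add: reset_def)

lemma measurable_reset_future: "reset (Suc k) \<in> measurable (future T k) S"
proof (rule measurable_S_I)
  fix j
  show "(\<lambda>x. reset (Suc k) x j) \<in> measurable (future T k) (borel_of (T j))"
    by (cases "j < Suc k") (auto simp: reset_def intro: measurable_future_component)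
qed

lemma measurable_future_if_depends:
  assumes "f \<in> measurable S N" "depends_from (Suc k) f"
  shows "f \<in> measurable (future T k) N"
proof -
  have "(\<lambda>x. f (reset (Suc k) x)) \<in> measurable (future T k) N"
    by (rule measurable_compose[OF measurable_reset_future assms(1)])
  moreover have "f (reset (Suc k) x) = f x" if "x \<in> space (future T k)" for x
    using depends_from_reset[OF assms(2), of x] that by simp
  ultimately show ?thesis
    by (subst (asm) measurable_cong[where g=f])
qed

lemma measurable_reset [measurable]: "reset n \<in> measurable S S"
proof (rule measurable_S_I)
  fix j
  show "(\<lambda>x. reset n x j) \<in> measurable S (borel_of (T j))"
    by (cases "j < n") (auto simp: reset_def)
qed


text \<open>
  \<open>future T k\<close> contains the coordinates strictly after \<open>k\<close>, whence the index \<open>Suc k\<close>.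
\<close>

lemma sets_future_iff:
  "A \<in> sets (future T k) \<longleftrightarrow> A \<in> sets S \<and> depends_from (Suc k) (\<lambda>x. x \<in> A)"
proof
  assume A: "A \<in> sets S \<and> depends_from (Suc k) (\<lambda>x. x \<in> A)"
  then have [measurable]: "A \<in> sets S" by simp
  have "(\<lambda>x. x \<in> A) \<in> measurable (future T k) (count_space UNIV)"
    by (rule measurable_future_if_depends) (use A in auto)
  from measurable_sets[OF this, of "{True}"]
  have "{x \<in> \<Omega>. x \<in> A} \<in> sets (future T k)"
    by (simp add: vimage_def Int_def conj_commute)
  moreover have "{x \<in> \<Omega>. x \<in> A} = A"
    using sets.sets_into_space[of A S] by auto
  ultimately show "A \<in> sets (future T k)" by simp
qed (use sets_future_S depends_from_future in blast)

section \<open>Solutions are the resampling-invariant measures\<close>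

definition prob_on_S :: "(nat \<Rightarrow> 'a) measure \<Rightarrow> bool" where
  "prob_on_S P \<longleftrightarrow> prob_space P \<and> sets P = sets S"

lemma borel_prob_measure_X_iff: "borel_prob_measure X P \<longleftrightarrow> prob_on_S P"
  by (simp add: borel_prob_measure_def prob_on_S_def sets_borel_X)

lemma prob_on_S_D:
  assumes "prob_on_S P"
  shows "prob_space P" "sets P = sets S" "space P = \<Omega>"
proof -
  show "prob_space P" "sets P = sets S" using assms by (auto simp: prob_on_S_def)
  then show "space P = \<Omega>" using sets_eq_imp_space_eq[of P S] by simp
qed

lemma bounded_measurable_integrable:
  assumes "prob_on_S P" "bounded_measurable c f"
  shows "integrable P f"
proof -
  interpret prob_space P by (rule prob_on_S_D[OF assms(1)])
  note [measurable_cong] = prob_on_S_D(2)[OF assms(1)]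
  show ?thesis
    using assms(2) prob_on_S_D(3)[OF assms(1)] unfolding bounded_measurable_def
    by (intro integrable_const_bound[where B=c]) (auto intro!: AE_I2)
qed

lemma bounded_measurable_mult:
  assumes "bounded_measurable c f" "bounded_measurable d g"
  shows "bounded_measurable (c * d) (\<lambda>x. f x * g x)"
  using assms unfolding bounded_measurable_def
  by (auto simp: abs_mult intro!: mult_mono order_trans[OF abs_ge_zero])

lemma bounded_measurable_add:
  assumes "bounded_measurable c f" "bounded_measurable d g"
  shows "bounded_measurable (c + d) (\<lambda>x. f x + g x)"
  using assms unfolding bounded_measurable_def
  by (auto intro!: order_trans[OF abs_triangle_ineq] add_mono)

lemma bounded_measurable_const: "bounded_measurable \<bar>c\<bar> (\<lambda>x. c)"
  by (simp add: bounded_measurable_def)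

lemma bounded_measurable_indicator:
  "A \<in> sets S \<Longrightarrow> bounded_measurable 1 (indicator A)"
  by (auto simp: bounded_measurable_def indicator_def)

text \<open>
  The conditional expectations in the definition of a solution condition on the coordinates after
  \<open>n\<close> and test only functions of the coordinate \<open>n\<close>. The present form uses plain integrals,
  and functions of all coordinates from \<open>n\<close> on.
\<close>

definition resampling_invariant :: "(nat \<Rightarrow> 'a) measure \<Rightarrow> bool" where
  "resampling_invariant P \<longleftrightarrow>
     (\<forall>n c f. bounded_measurable c f \<and> depends_from n f \<longrightarrow> (\<integral>x. f x \<partial>P) = (\<integral>x. smooth n f x \<partial>P))"

lemma resampling_invariantD:
  "resampling_invariant P \<Longrightarrow> bounded_measurable c f \<Longrightarrow> depends_from n f \<Longrightarrow>
    (\<integral>x. f x \<partial>P) = (\<integral>x. smooth n f x \<partial>P)"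
  unfolding resampling_invariant_def by simp

lemma finite_measure_subalgebra_future:
  assumes "prob_on_S P"
  shows "finite_measure_subalgebra P (future T k)"
proof -
  interpret prob_space P by (rule prob_on_S_D[OF assms])
  show ?thesis
    by unfold_locales (use sets_future_S prob_on_S_D[OF assms] in \<open>simp add: subalgebra_def\<close>)
qed

lemma component_bounded_measurable:
  fixes f :: "'a \<Rightarrow> real"
  assumes "f \<in> borel_measurable (borel_of (T k))" "\<And>z. z \<in> carrier (G k) \<Longrightarrow> \<bar>f z\<bar> \<le> c"
  shows "bounded_measurable c (\<lambda>x. f (x k))"
  unfolding bounded_measurable_def
proof
  show "(\<lambda>x. f (x k)) \<in> borel_measurable S"
    by (rule measurable_compose[OF measurable_component_S assms(1)])
qed (use assms(2) in auto)

lemma smooth_component: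
  "smooth k (\<lambda>x. f (x k)) x = (\<integral>z. f (\<phi> k (x (Suc k)) \<otimes>\<^bsub>G k\<^esub> z) \<partial>\<mu> k)"
  by (simp add: smooth_def resample_def)

lemma depends_from_component: "n \<le> k \<Longrightarrow> depends_from n (\<lambda>x. f (x k))"
  by (rule depends_fromI) simp

lemma depends_from_indicator:
  assumes "depends_from n (\<lambda>x. x \<in> A)"
  shows "depends_from n (indicator A :: _ \<Rightarrow> real)"
proof (rule depends_fromI)
  fix x y assume "x \<in> \<Omega>" "y \<in> \<Omega>" "\<And>j. n \<le> j \<Longrightarrow> x j = y j"
  then have "(x \<in> A) = (y \<in> A)" by (rule depends_fromD[OF assms])
  then show "(indicator A x :: real) = indicator A y" by (simp add: indicator_def)
qed

text \<open>
  Multiplying a function of the coordinate \<open>k\<close> by the indicator of a future event gives a function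
  of the coordinates from \<open>k\<close> on; invariance for it is the defining identity of the conditional
  expectation.
\<close>

lemma resampling_invariant_imp_solution:
  assumes P: "prob_on_S P" and inv: "resampling_invariant P"
  shows "P \<in> solutions G T \<phi> \<mu>"
  unfolding solutions_def mem_Collect_eq borel_prob_measure_X_iff
proof (intro conjI allI impI P)
  fix k and f :: "'a \<Rightarrow> real"
  assume f: "f \<in> borel_measurable (borel_of (T k)) \<and> bounded (f ` topspace (T k))"
  then obtain c where c: "\<And>z. z \<in> carrier (G k) \<Longrightarrow> \<bar>f z\<bar> \<le> c"
    by (auto simp: bounded_iff)
  interpret finite_measure_subalgebra P "future T k"
    by (rule finite_measure_subalgebra_future[OF P])
  let ?f = "\<lambda>x. f (x k)"
  have bf: "bounded_measurable c ?f" using f c by (intro component_bounded_measurable) auto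
  have bs: "bounded_measurable c (smooth k ?f)" by (rule bounded_measurable_smooth[OF bf])
  have "AE x in P. real_cond_exp P (future T k) ?f x = smooth k ?f x"
  proof (rule real_cond_exp_charact)
    fix A assume A: "A \<in> sets (future T k)"
    then have AS: "A \<in> sets S" and Ad: "depends_from (Suc k) (indicator A :: _ \<Rightarrow> real)"
      by (auto simp: sets_future_iff intro: depends_from_indicator)
    have "(\<integral>x. indicator A x * f (x k) \<partial>P) = (\<integral>x. smooth k (\<lambda>x. indicator A x * f (x k)) x \<partial>P)"
    proof (rule resampling_invariantD[OF inv])
      show "bounded_measurable (1 * c) (\<lambda>x. indicator A x * f (x k))"
        by (rule bounded_measurable_mult[OF bounded_measurable_indicator[OF AS] bf])
      show "depends_from k (\<lambda>x. indicator A x * f (x k))"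
      proof (rule depends_fromI)
        fix x y assume xy: "x \<in> \<Omega>" "y \<in> \<Omega>" "\<And>j. k \<le> j \<Longrightarrow> x j = y j"
        then have "(indicator A x :: real) = indicator A y"
          by (intro depends_fromD[OF Ad]) auto
        then show "indicator A x * f (x k) = indicator A y * f (y k)" using xy(3)[of k] by simp
      qed
    qed
    also have "\<dots> = (\<integral>x. indicator A x * smooth k ?f x \<partial>P)"
      by (intro Bochner_Integration.integral_cong refl smooth_mult_depends Ad)
        (simp add: prob_on_S_D[OF P])
    finally show "(\<integral>x\<in>A. f (x k) \<partial>P) = (\<integral>x\<in>A. smooth k ?f x \<partial>P)"
      by (simp add: set_lebesgue_integral_def)
  next
    show "smooth k ?f \<in> borel_measurable (future T k)"
      using bs by (intro measurable_future_if_depends depends_from_smooth depends_from_component)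
        (auto simp: bounded_measurable_def)
  qed (rule bounded_measurable_integrable[OF P bf] bounded_measurable_integrable[OF P bs])+
  then show "AE x in P. real_cond_exp P (future T k) ?f x =
      (\<integral>z. f (\<phi> k (x (Suc k)) \<otimes>\<^bsub>G k\<^esub> z) \<partial>\<mu> k)"
    by (simp add: smooth_component)
qed

lemma solution_prob_on_S: "P \<in> solutions G T \<phi> \<mu> \<Longrightarrow> prob_on_S P"
  by (simp add: solutions_def borel_prob_measure_X_iff)

lemma solution_set_integral:
  assumes P: "P \<in> solutions G T \<phi> \<mu>" and D: "D \<in> sets (future T k)" and A: "A \<in> sets (borel_of (T k))"
  shows "(\<integral>x. indicator D x * indicator A (x k) \<partial>P) =
    (\<integral>x. indicator D x * smooth k (\<lambda>x. indicator A (x k)) x \<partial>P :: real)"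
proof -
  note P' = solution_prob_on_S[OF P]
  interpret finite_measure_subalgebra P "future T k"
    by (rule finite_measure_subalgebra_future[OF P'])
  note [measurable_cong] = prob_on_S_D(2)[OF P']
  let ?f = "\<lambda>x. indicator A (x k) :: real"
  have bf: "bounded_measurable 1 ?f"
    using A by (intro component_bounded_measurable) (auto simp: indicator_def)
  have [measurable]: "smooth k ?f \<in> borel_measurable S"
    using bounded_measurable_smooth[OF bf] by (simp add: bounded_measurable_def)
  have [measurable]: "D \<in> sets S" using D sets_future_S by blast
  have AE: "AE x in P. real_cond_exp P (future T k) ?f x = smooth k ?f x"
  proof -
    have "(indicator A :: 'a \<Rightarrow> real) \<in> borel_measurable (borel_of (T k)) \<and> bounded ((indicator A :: 'a \<Rightarrow> real) ` topspace (T k))"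
      using A by (auto simp: bounded_iff indicator_def intro!: exI[of _ 1])
    from P[unfolded solutions_def mem_Collect_eq, THEN conjunct2, rule_format, OF this]
    show ?thesis unfolding smooth_component .
  qed
  have "(\<integral>x\<in>D. ?f x \<partial>P) = (\<integral>x\<in>D. real_cond_exp P (future T k) ?f x \<partial>P)"
    by (rule real_cond_exp_intA[OF bounded_measurable_integrable[OF P' bf] D])
  also have "\<dots> = (\<integral>x\<in>D. smooth k ?f x \<partial>P)"
    unfolding set_lebesgue_integral_def using AE
    by (intro integral_cong_AE) (auto)
  finally show ?thesis by (simp add: set_lebesgue_integral_def)
qed

lemma measurable_component_S_comp [measurable (raw)]:
  assumes "f \<in> measurable N S"
  shows "(\<lambda>p. f p k) \<in> measurable N (borel_of (T k))"
  by (rule measurable_compose[OF assms measurable_component_S])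

lemma integral_smooth_eq_pair:
  assumes P: "prob_on_S P" and f: "bounded_measurable c f"
  shows "(\<integral>x. smooth n f x \<partial>P) = (\<integral>p. f (resample G \<phi> n (fst p) (snd p)) \<partial>(P \<Otimes>\<^sub>M \<mu> n))"
proof -
  interpret P: prob_space P by (rule prob_on_S_D[OF P])
  interpret M: prob_space "\<mu> n" by (rule prob_space_mu)
  interpret PM: pair_prob_space P "\<mu> n" ..
  note [measurable_cong] = prob_on_S_D(2)[OF P]
  have [measurable]: "f \<in> borel_measurable S" using f by (simp add: bounded_measurable_def)
  have "integrable (P \<Otimes>\<^sub>M \<mu> n) (\<lambda>p. f (resample G \<phi> n (fst p) (snd p)))"
  proof (rule PM.integrable_const_bound[where B=c])
    show "AE p in P \<Otimes>\<^sub>M \<mu> n. norm (f (resample G \<phi> n (fst p) (snd p))) \<le> c"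
    proof (rule AE_I2)
      fix p assume "p \<in> space (P \<Otimes>\<^sub>M \<mu> n)"
      then have "resample G \<phi> n (fst p) (snd p) \<in> \<Omega>"
        by (intro resample_closed) (auto simp: space_pair_measure prob_on_S_D[OF P])
      then show "norm (f (resample G \<phi> n (fst p) (snd p))) \<le> c"
        using f by (simp add: bounded_measurable_def)
    qed
  qed measurable
  from PM.integral_fst'[OF this] show ?thesis by (simp add: smooth_def)
qed

text \<open>
  Resampling invariance for products of indicators extends to all functions of the coordinates from
  \<open>n\<close> on by comparing laws on boxes. Resetting the earlier coordinates to \<open>1\<close> makes it an
  identity between two measures on the whole product, to which the uniqueness theorem for
  infinite products applies.
\<close>

lemma solution_reset_law:
  assumes P: "P \<in> solutions G T \<phi> \<mu>"
  shows "distr P S (reset n) =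
    distr (P \<Otimes>\<^sub>M \<mu> n) S (\<lambda>p. reset n (resample G \<phi> n (fst p) (snd p)))" (is "?P1 = ?P2")
proof (rule measure_eqI_PiM_infinite)
  note P' = solution_prob_on_S[OF P]
  interpret P: prob_space P by (rule prob_on_S_D[OF P'])
  interpret M: prob_space "\<mu> n" by (rule prob_space_mu)
  interpret PM: pair_prob_space P "\<mu> n" ..
  note [measurable_cong] = prob_on_S_D(2)[OF P']
  have m1 [measurable]: "reset n \<in> measurable P S" by measurable
  have m2 [measurable]: "(\<lambda>p. reset n (resample G \<phi> n (fst p) (snd p))) \<in> measurable (P \<Otimes>\<^sub>M \<mu> n) S"
    by measurable
  show "sets ?P1 = sets S" "sets ?P2 = sets S" by simp_all
  show "finite_measure ?P1" using P.finite_measure_distr[OF m1] .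
  interpret P1: prob_space ?P1 by (rule P.prob_space_distr[OF m1])
  interpret P2: prob_space ?P2 by (rule PM.prob_space_distr[OF m2])
  fix A J assume J: "finite J" "J \<subseteq> (UNIV :: nat set)" and A: "\<And>i. i \<in> J \<Longrightarrow> A i \<in> sets (borel_of (T i))"
  let ?E = "prod_emb UNIV (\<lambda>k. borel_of (T k)) J (Pi\<^sub>E J A)"
  have E: "?E = {x \<in> \<Omega>. \<forall>i\<in>J. x i \<in> A i}"
  proof (rule Set.set_eqI)
    fix x
    have "x \<in> ?E \<longleftrightarrow> (\<forall>i. x i \<in> carrier (G i)) \<and> (\<forall>i\<in>J. x i \<in> A i)"
      by (auto simp: prod_emb_iff)
    then show "x \<in> ?E \<longleftrightarrow> x \<in> {x \<in> \<Omega>. \<forall>i\<in>J. x i \<in> A i}"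
      by (simp add: \<Omega>_iff)
  qed
  have ES [measurable]: "?E \<in> sets S" using J A by (intro sets_PiM_I) auto
  have E\<Omega>: "?E \<inter> \<Omega> = ?E" unfolding E by blast
  \<comment> \<open>The box splits into a future event \<open>D\<close>, a condition \<open>An\<close> on the coordinate \<open>n\<close>, vacuous if
    \<open>n\<close> is not among the indices of the box, and a condition \<open>q\<close> on the coordinates
    reset to \<open>1\<close>, which does not depend on the point.\<close>
  define An where "An = (if n \<in> J then A n else carrier (G n))"
  have An [measurable]: "An \<in> sets (borel_of (T n))"
    using A sets.top[of "borel_of (T n)"] by (auto simp: An_def)
  define D where "D = {x \<in> \<Omega>. \<forall>i\<in>J. n < i \<longrightarrow> x i \<in> A i}"
  define q where "q \<longleftrightarrow> (\<forall>i\<in>J. i < n \<longrightarrow> \<one>\<^bsub>G i\<^esub> \<in> A i)"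
  have D: "D \<in> sets (future T n)"
  proof -
    have "D = (\<Inter>i\<in>J. if n < i then (\<lambda>x. x i) -` A i \<inter> \<Omega> else \<Omega>) \<inter> \<Omega>"
      by (auto simp: D_def split: if_splits)
    also have "\<dots> \<in> sets (future T n)"
    proof (cases "J = {}")
      case True
      then show ?thesis using sets.top[of "future T n"] by simp
    next
      case False
      have "(if n < i then (\<lambda>x. x i) -` A i \<inter> \<Omega> else \<Omega>) \<in> sets (future T n)" if "i \<in> J" for i
        using measurable_sets[OF measurable_future_component A[OF that]] sets.top[of "future T n"] by simp
      then have "(\<Inter>i\<in>J. if n < i then (\<lambda>x. x i) -` A i \<inter> \<Omega> else \<Omega>) \<in> sets (future T n)"
        by (intro sets.finite_INT J False)
      then show ?thesis using sets.top[of "future T n"] by (intro sets.Int) simp_all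
    qed
    finally show ?thesis .
  qed
  have DS [measurable]: "D \<in> sets S" using D sets_future_S by blast
  have iff: "reset n x \<in> ?E \<longleftrightarrow> q \<and> x \<in> D \<and> x n \<in> An" if x: "x \<in> \<Omega>" for x
  proof -
    have "reset n x \<in> ?E \<longleftrightarrow> (\<forall>i\<in>J. reset n x i \<in> A i)"
      unfolding E using reset_closed[OF x] by simp
    also have "\<dots> \<longleftrightarrow> q \<and> (n \<in> J \<longrightarrow> x n \<in> A n) \<and> (\<forall>i\<in>J. n < i \<longrightarrow> x i \<in> A i)"
    proof -
      have "reset n x i \<in> A i \<longleftrightarrow> (i < n \<longrightarrow> \<one>\<^bsub>G i\<^esub> \<in> A i) \<and> (i = n \<longrightarrow> x n \<in> A n) \<and> (n < i \<longrightarrow> x i \<in> A i)" for i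
        by (cases i n rule: linorder_cases) (auto simp: reset_def)
      then show ?thesis unfolding q_def by auto
    qed
    finally show ?thesis using x by (auto simp: D_def An_def)
  qed
  let ?g = "\<lambda>x. indicator D x * indicator An (x n) :: real"
  let ?c = "if q then 1 else 0 :: real"
  have ind: "indicator ?E (reset n x) = ?c * ?g x" if "x \<in> \<Omega>" for x
    using iff[OF that] by (simp add: indicator_def)
  have gb: "bounded_measurable 1 ?g"
    by (auto simp: bounded_measurable_def indicator_def)
  have "measure ?P1 ?E = (\<integral>x. indicator ?E (reset n x) \<partial>P)"
    by (subst integral_distr[OF m1, symmetric]) (auto simp: E\<Omega>)
  also have "\<dots> = (\<integral>x. ?c * ?g x \<partial>P)"
    by (intro Bochner_Integration.integral_cong refl ind) (simp add: prob_on_S_D[OF P'])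
  also have "\<dots> = ?c * (\<integral>x. ?g x \<partial>P)"
    by simp
  also have "(\<integral>x. ?g x \<partial>P) = (\<integral>x. indicator D x * smooth n (\<lambda>x. indicator An (x n)) x \<partial>P)"
    by (rule solution_set_integral[OF P D An])
  also have "\<dots> = (\<integral>x. smooth n ?g x \<partial>P)"
    using depends_from_indicator[OF depends_from_future[OF D]]
    by (intro Bochner_Integration.integral_cong refl smooth_mult_depends[symmetric])
      (auto simp: prob_on_S_D[OF P'])
  also have "\<dots> = (\<integral>p. ?g (resample G \<phi> n (fst p) (snd p)) \<partial>(P \<Otimes>\<^sub>M \<mu> n))"
    by (rule integral_smooth_eq_pair[OF P' gb])
  also have "?c * \<dots> = (\<integral>p. ?c * ?g (resample G \<phi> n (fst p) (snd p)) \<partial>(P \<Otimes>\<^sub>M \<mu> n))"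
    by simp
  also have "\<dots> = (\<integral>p. indicator ?E (reset n (resample G \<phi> n (fst p) (snd p))) \<partial>(P \<Otimes>\<^sub>M \<mu> n))"
    by (intro Bochner_Integration.integral_cong refl ind[symmetric] resample_closed)
      (auto simp: space_pair_measure prob_on_S_D[OF P'])
  also have "\<dots> = measure ?P2 ?E"
    by (subst integral_distr[OF m2, symmetric]) (auto simp: E\<Omega>)
  finally show "emeasure ?P1 ?E = emeasure ?P2 ?E"
    by (simp add: P1.emeasure_eq_measure P2.emeasure_eq_measure)
qed

lemma solution_resampling_invariant:
  assumes P: "P \<in> solutions G T \<phi> \<mu>"
  shows "resampling_invariant P"
  unfolding resampling_invariant_def
proof (intro allI impI, elim conjE)
  fix n c f assume f: "bounded_measurable c f" and d: "depends_from n f"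
  note P' = solution_prob_on_S[OF P]
  note [measurable_cong] = prob_on_S_D(2)[OF P']
  have fm [measurable]: "f \<in> borel_measurable S" using f by (simp add: bounded_measurable_def)
  have m1: "reset n \<in> measurable P S" by measurable
  have m2: "(\<lambda>p. reset n (resample G \<phi> n (fst p) (snd p))) \<in> measurable (P \<Otimes>\<^sub>M \<mu> n) S"
    by measurable
  have "(\<integral>x. f x \<partial>P) = (\<integral>x. f (reset n x) \<partial>P)"
    by (intro Bochner_Integration.integral_cong refl depends_from_reset[OF d, symmetric])
      (simp add: prob_on_S_D[OF P'])
  also have "\<dots> = (\<integral>x. f x \<partial>distr P S (reset n))"
    by (rule integral_distr[OF m1 fm, symmetric])
  also have "\<dots> = (\<integral>p. f (reset n (resample G \<phi> n (fst p) (snd p))) \<partial>(P \<Otimes>\<^sub>M \<mu> n))"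
    unfolding solution_reset_law[OF P] by (rule integral_distr[OF m2 fm])
  also have "\<dots> = (\<integral>p. f (resample G \<phi> n (fst p) (snd p)) \<partial>(P \<Otimes>\<^sub>M \<mu> n))"
    by (intro Bochner_Integration.integral_cong refl depends_from_reset[OF d] resample_closed)
      (auto simp: space_pair_measure prob_on_S_D[OF P'])
  also have "\<dots> = (\<integral>x. smooth n f x \<partial>P)"
    by (rule integral_smooth_eq_pair[OF P' f, symmetric])
  finally show "(\<integral>x. f x \<partial>P) = (\<integral>x. smooth n f x \<partial>P)" .
qed

theorem solutions_iff:
  "P \<in> solutions G T \<phi> \<mu> \<longleftrightarrow> prob_on_S P \<and> resampling_invariant P"
  using solution_prob_on_S solution_resampling_invariant resampling_invariant_imp_solution by blast

section \<open>Averaging over the first coordinates\<close>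

text \<open>
  For every solution and bounded measurable \<open>f\<close>, \<open>avg n f\<close> is a version of the conditional expectation of \<open>f\<close> given the
  coordinates from \<open>n\<close> on. Being defined pointwise, and not only up to null sets, it can be
  evaluated at single points and compared between different solutions.
\<close>

primrec avg :: "nat \<Rightarrow> ((nat \<Rightarrow> 'a) \<Rightarrow> real) \<Rightarrow> (nat \<Rightarrow> 'a) \<Rightarrow> real" where
  "avg 0 f = f"
| "avg (Suc n) f = smooth n (avg n f)"

lemma bounded_measurable_avg: "bounded_measurable c f \<Longrightarrow> bounded_measurable c (avg n f)"
  by (induction n) (simp_all add: bounded_measurable_smooth)

lemma depends_from_avg: "depends_from n (avg n f)"
  by (induction n) (simp_all add: depends_from_smooth)

lemma smooth_cong:
  assumes "\<And>x. x \<in> \<Omega> \<Longrightarrow> f x = g x" "x \<in> \<Omega>"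
  shows "smooth k f x = smooth k g x"
  unfolding smooth_def using assms by (intro Bochner_Integration.integral_cong refl) simp

lemma avg_mult_depends:
  "depends_from n w \<Longrightarrow> x \<in> \<Omega> \<Longrightarrow> avg n (\<lambda>x. w x * f x) x = w x * avg n f x"
proof (induction n arbitrary: x)
  case (Suc n)
  have "depends_from n w" by (rule depends_from_mono[OF Suc.prems(1)]) simp
  then have "smooth n (avg n (\<lambda>x. w x * f x)) x = smooth n (\<lambda>x. w x * avg n f x) x"
    by (intro smooth_cong Suc.IH Suc.prems)
  then show ?case by (simp add: smooth_mult_depends[OF Suc.prems])
qed simp

lemma integrable_resample:
  assumes "bounded_measurable c f" "x \<in> \<Omega>"
  shows "integrable (\<mu> k) (\<lambda>z. f (resample G \<phi> k x z))"
proof -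
  interpret prob_space "\<mu> k" by (rule prob_space_mu)
  have [measurable]: "f \<in> borel_measurable S" using assms by (simp add: bounded_measurable_def)
  have "AE z in \<mu> k. norm (f (resample G \<phi> k x z)) \<le> c"
    using assms unfolding bounded_measurable_def by (intro AE_I2) simp
  then show ?thesis
  proof (rule integrable_const_bound)
    have "(\<lambda>z. resample G \<phi> k x z) \<in> measurable (\<mu> k) S"
      using assms(2) by (intro measurable_resample measurable_const measurable_ident_sets sets_mu) simp
    then show "(\<lambda>z. f (resample G \<phi> k x z)) \<in> borel_measurable (\<mu> k)"
      by measurable
  qed
qed

lemma smooth_diff:
  assumes "bounded_measurable c f" "bounded_measurable d g" "x \<in> \<Omega>"
  shows "smooth k (\<lambda>x. f x - g x) x = smooth k f x - smooth k g x"
  unfolding smooth_def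
  by (intro Bochner_Integration.integral_diff integrable_resample[OF assms(1,3)] integrable_resample[OF assms(2,3)])

lemma avg_diff:
  assumes "bounded_measurable c f" "bounded_measurable d g"
  shows "x \<in> \<Omega> \<Longrightarrow> avg n (\<lambda>x. f x - g x) x = avg n f x - avg n g x"
proof (induction n arbitrary: x)
  case (Suc n)
  have "smooth n (avg n (\<lambda>x. f x - g x)) x = smooth n (\<lambda>x. avg n f x - avg n g x) x"
    by (intro smooth_cong Suc.IH Suc.prems)
  also have "\<dots> = smooth n (avg n f) x - smooth n (avg n g) x"
    by (rule smooth_diff[OF bounded_measurable_avg[OF assms(1)] bounded_measurable_avg[OF assms(2)] Suc.prems])
  finally show ?case by simp
qed simp

lemma avg_dist_le:
  assumes "bounded_measurable c f" "bounded_measurable d g" "x \<in> \<Omega>"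
    and "\<And>y. y \<in> \<Omega> \<Longrightarrow> \<bar>f y - g y\<bar> \<le> e"
  shows "\<bar>avg n f x - avg n g x\<bar> \<le> e"
proof -
  have "bounded_measurable e (\<lambda>x. f x - g x)"
    using assms by (auto simp: bounded_measurable_def)
  from bounded_measurable_avg[OF this, of n]
  have "\<bar>avg n (\<lambda>x. f x - g x) x\<bar> \<le> e"
    using assms(3) by (simp add: bounded_measurable_def)
  then show ?thesis using avg_diff[OF assms(1,2,3), of n] by simp
qed

lemma integral_avg:
  assumes "resampling_invariant P" "bounded_measurable c f"
  shows "(\<integral>x. avg n f x \<partial>P) = (\<integral>x. f x \<partial>P)"
proof (induction n)
  case (Suc n)
  have "(\<integral>x. avg n f x \<partial>P) = (\<integral>x. smooth n (avg n f) x \<partial>P)"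
    by (rule resampling_invariantD[OF assms(1) bounded_measurable_avg[OF assms(2)] depends_from_avg])
  with Suc show ?case by simp
qed simp

text \<open>
  The weight \<open>w\<close> passes through the averaging because resampling the first \<open>n\<close> coordinates leaves
  it unchanged.
\<close>

lemma integral_mult_avg:
  assumes P: "P \<in> solutions G T \<phi> \<mu>"
    and f: "bounded_measurable c f" and w: "bounded_measurable d w" "depends_from n w"
  shows "(\<integral>x. w x * avg n f x \<partial>P) = (\<integral>x. w x * f x \<partial>P)"
proof -
  have P': "prob_on_S P" "resampling_invariant P" using P solutions_iff by auto
  have "(\<integral>x. w x * avg n f x \<partial>P) = (\<integral>x. avg n (\<lambda>x. w x * f x) x \<partial>P)"
    by (intro Bochner_Integration.integral_cong refl avg_mult_depends[symmetric] w)
      (simp add: prob_on_S_D[OF P'(1)])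
  also have "\<dots> = (\<integral>x. w x * f x \<partial>P)"
    by (rule integral_avg[OF P'(2) bounded_measurable_mult[OF w(1) f]])
  finally show ?thesis .
qed

lemma integral_avg_mult_avg:
  assumes P: "P \<in> solutions G T \<phi> \<mu>" and f: "bounded_measurable c f" and "m \<le> n"
  shows "(\<integral>x. avg n f x * avg m f x \<partial>P) = (\<integral>x. (avg n f x)\<^sup>2 \<partial>P)"
proof -
  note b = bounded_measurable_avg[OF f, of n]
  have "(\<integral>x. avg n f x * avg m f x \<partial>P) = (\<integral>x. avg n f x * f x \<partial>P)"
    by (rule integral_mult_avg[OF P f b depends_from_mono[OF depends_from_avg \<open>m \<le> n\<close>]])
  also have "\<dots> = (\<integral>x. avg n f x * avg n f x \<partial>P)"
    by (rule integral_mult_avg[OF P f b depends_from_avg, symmetric])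
  finally show ?thesis by (simp add: power2_eq_square)
qed

lemma bounded_measurable_power2:
  "bounded_measurable c f \<Longrightarrow> bounded_measurable (c * c) (\<lambda>x. (f x)\<^sup>2)"
  unfolding power2_eq_square by (rule bounded_measurable_mult)

lemma bounded_measurable_minus: "bounded_measurable c f \<Longrightarrow> bounded_measurable c (\<lambda>x. - f x)"
  by (simp add: bounded_measurable_def)

lemma bounded_measurable_diff:
  "bounded_measurable c f \<Longrightarrow> bounded_measurable d g \<Longrightarrow> bounded_measurable (c + d) (\<lambda>x. f x - g x)"
  using bounded_measurable_add[OF _ bounded_measurable_minus] by fastforce

text \<open>
  Orthogonality of the increments of a reverse martingale: both the mixed moment and the second moment
  of the later term equal the integral of \<open>f\<close> against that term.
\<close>

lemma integral_avg_diff_square: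
  assumes P: "P \<in> solutions G T \<phi> \<mu>" and f: "bounded_measurable c f" and mn: "m \<le> n"
  shows "(\<integral>x. (avg m f x - avg n f x)\<^sup>2 \<partial>P) = (\<integral>x. (avg m f x)\<^sup>2 \<partial>P) - (\<integral>x. (avg n f x)\<^sup>2 \<partial>P)"
proof -
  note P' = solution_prob_on_S[OF P]
  note b = bounded_measurable_avg[OF f]
  note i = bounded_measurable_integrable[OF P']
  have i1: "integrable P (\<lambda>x. (avg k f x)\<^sup>2)" for k
    by (rule i[OF bounded_measurable_power2[OF b]])
  have i2: "integrable P (\<lambda>x. avg n f x * avg m f x)"
    by (rule i[OF bounded_measurable_mult[OF b b]])
  have "(\<integral>x. (avg m f x - avg n f x)\<^sup>2 \<partial>P) =
      (\<integral>x. (avg m f x)\<^sup>2 + (avg n f x)\<^sup>2 - 2 * (avg n f x * avg m f x) \<partial>P)"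
    by (intro Bochner_Integration.integral_cong refl) (simp add: power2_diff mult.commute)
  also have "\<dots> = (\<integral>x. (avg m f x)\<^sup>2 \<partial>P) + (\<integral>x. (avg n f x)\<^sup>2 \<partial>P) - 2 * (\<integral>x. avg n f x * avg m f x \<partial>P)"
    using i1 i2 by simp
  finally show ?thesis using integral_avg_mult_avg[OF P f mn] by simp
qed

section \<open>Tail triviality of extreme solutions\<close>

text \<open>
  A tail function can be moved through every resampling step, so reweighting a solution by a tail
  density preserves resampling invariance.
\<close>

lemma density_solution:
  assumes P: "P \<in> solutions G T \<phi> \<mu>" and w: "bounded_measurable d w"
    and dep: "\<And>n. depends_from n w" and nonneg: "\<And>x. x \<in> \<Omega> \<Longrightarrow> 0 \<le> w x"
    and one: "(\<integral>x. w x \<partial>P) = 1"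
  shows "density P (\<lambda>x. ennreal (w x)) \<in> solutions G T \<phi> \<mu>" (is "?R \<in> _")
    and "\<And>c f. bounded_measurable c f \<Longrightarrow> (\<integral>x. f x \<partial>density P (\<lambda>x. ennreal (w x))) = (\<integral>x. w x * f x \<partial>P)"
proof -
  have P': "prob_on_S P" "resampling_invariant P" using P solutions_iff by auto
  note [measurable_cong] = prob_on_S_D(2)[OF P'(1)]
  note sp = prob_on_S_D(3)[OF P'(1)]
  have wm [measurable]: "w \<in> borel_measurable S" using w by (simp add: bounded_measurable_def)
  have AE: "AE x in P. 0 \<le> w x" using nonneg by (intro AE_I2) (simp add: sp)
  have int: "(\<integral>x. f x \<partial>?R) = (\<integral>x. w x * f x \<partial>P)" if f: "bounded_measurable c f" for c f
  proof -
    have [measurable]: "f \<in> borel_measurable S" using f by (simp add: bounded_measurable_def)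
    show ?thesis by (subst integral_real_density) (use AE in auto)
  qed
  then show "\<And>c f. bounded_measurable c f \<Longrightarrow> (\<integral>x. f x \<partial>?R) = (\<integral>x. w x * f x \<partial>P)" .
  have "emeasure ?R (space ?R) = (\<integral>\<^sup>+x. ennreal (w x) \<partial>P)"
    by (subst emeasure_density) (auto intro!: nn_integral_cong)
  also have "\<dots> = 1"
    using nn_integral_eq_integral[OF bounded_measurable_integrable[OF P'(1) w] AE] one by simp
  finally have "prob_space ?R" by (rule prob_spaceI)
  then have R: "prob_on_S ?R" by (simp add: prob_on_S_def prob_on_S_D(2)[OF P'(1)])
  have "resampling_invariant ?R"
    unfolding resampling_invariant_def
  proof (intro allI impI, elim conjE)
    fix n c f assume f: "bounded_measurable c f" and d: "depends_from n f"
    have "(\<integral>x. f x \<partial>?R) = (\<integral>x. w x * f x \<partial>P)" by (rule int[OF f])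
    also have "\<dots> = (\<integral>x. smooth n (\<lambda>x. w x * f x) x \<partial>P)"
    proof (rule resampling_invariantD[OF P'(2) bounded_measurable_mult[OF w f]])
      show "depends_from n (\<lambda>x. w x * f x)"
        by (rule depends_fromI) (metis depends_fromD[OF dep] depends_fromD[OF d])
    qed
    also have "\<dots> = (\<integral>x. w x * smooth n f x \<partial>P)"
      by (intro Bochner_Integration.integral_cong refl smooth_mult_depends dep) (simp add: sp)
    also have "\<dots> = (\<integral>x. smooth n f x \<partial>?R)"
      by (rule int[OF bounded_measurable_smooth[OF f], symmetric])
    finally show "(\<integral>x. f x \<partial>?R) = (\<integral>x. smooth n f x \<partial>?R)" .
  qed
  with R show "?R \<in> solutions G T \<phi> \<mu>" by (simp add: solutions_iff)
qed

lemma extreme_imp_solution: "P \<in> extreme_measures (solutions G T \<phi> \<mu>) \<Longrightarrow> P \<in> solutions G T \<phi> \<mu>"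
  by (simp add: extreme_measures_def)

lemma abs_integral_le:
  assumes "prob_on_S P" "bounded_measurable c f"
  shows "\<bar>\<integral>x. f x \<partial>P\<bar> \<le> c"
proof -
  interpret prob_space P by (rule prob_on_S_D[OF assms(1)])
  have "\<bar>\<integral>x. f x \<partial>P\<bar> \<le> (\<integral>x. \<bar>f x\<bar> \<partial>P)" by (rule integral_abs_bound)
  also have "\<dots> \<le> (\<integral>x. c \<partial>P)"
    using assms(2) prob_on_S_D(3)[OF assms(1)]
    by (intro integral_mono integrable_abs bounded_measurable_integrable[OF assms])
      (auto simp: bounded_measurable_def)
  finally show ?thesis using prob_space by simp
qed

text \<open>
  With \<open>e\<close> the mean of \<open>g\<close>, the densities \<open>1 + (g - e)/(4c)\<close> and \<open>1 - (g - e)/(4c)\<close> are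
  tail functions and average to \<open>1\<close>. By extremality the first gives back \<open>P\<close>, and integrating
  \<open>g\<close> against it shows that \<open>g\<close> has variance \<open>0\<close>.
\<close>

lemma extreme_tail_trivial:
  assumes ext: "P \<in> extreme_measures (solutions G T \<phi> \<mu>)" and g: "bounded_measurable c g" and c: "0 < c"
    and dep: "\<And>n. depends_from n g"
  shows "(\<integral>x. (g x)\<^sup>2 \<partial>P) = (\<integral>x. g x \<partial>P)\<^sup>2"
proof -
  note P = extreme_imp_solution[OF ext]
  note P' = solution_prob_on_S[OF P]
  interpret prob_space P by (rule prob_on_S_D[OF P'])
  note i = bounded_measurable_integrable[OF P']
  define e where "e = (\<integral>x. g x \<partial>P)"
  have e: "\<bar>e\<bar> \<le> c" unfolding e_def by (rule abs_integral_le[OF P' g])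
  define w where "w s x = 1 + s * ((g x - e) / (4 * c))" for s x
  have gc: "\<bar>g x\<bar> \<le> c" if "x \<in> \<Omega>" for x using g that by (simp add: bounded_measurable_def)
  \<comment> \<open>Since \<open>\<bar>g - e\<bar> \<le> 2c\<close>, the factor \<open>4c\<close> keeps the densities between \<open>1/2\<close> and \<open>3/2\<close>.\<close>
  have half: "\<bar>(g x - e) / (4 * c)\<bar> \<le> 1/2" if "x \<in> \<Omega>" for x
    using gc[OF that] e c by (simp add: abs_divide divide_le_eq)
  have gm [measurable]: "g \<in> borel_measurable S" using g by (simp add: bounded_measurable_def)
  have w02: "0 \<le> w s x \<and> w s x \<le> 2" if "s = 1 \<or> s = -1" "x \<in> \<Omega>" for s x
  proof -
    define t where "t = (g x - e) / (4 * c)"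
    have "\<bar>t\<bar> \<le> 1/2" unfolding t_def by (rule half[OF that(2)])
    then show ?thesis using that(1) unfolding w_def t_def[symmetric] by (elim disjE) auto
  qed
  have b: "bounded_measurable 2 (w s)" if s: "s = 1 \<or> s = -1" for s
    unfolding bounded_measurable_def
  proof (intro conjI ballI)
    show "w s \<in> borel_measurable S" unfolding w_def by measurable
    show "\<bar>w s x\<bar> \<le> 2" if "x \<in> \<Omega>" for x
      using w02[OF s that] by simp
  qed
  have sol: "density P (\<lambda>x. ennreal (w s x)) \<in> solutions G T \<phi> \<mu>" (is ?th1)
    and int: "\<And>d f. bounded_measurable d f \<Longrightarrow>
      (\<integral>x. f x \<partial>density P (\<lambda>x. ennreal (w s x))) = (\<integral>x. w s x * f x \<partial>P)" if s: "s = 1 \<or> s = -1" for s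
  proof -
    have d: "depends_from n (w s)" for n
      unfolding w_def
    proof (rule depends_fromI)
      fix x y assume "x \<in> \<Omega>" "y \<in> \<Omega>" "\<And>j. n \<le> j \<Longrightarrow> x j = y j"
      then have "g x = g y" by (rule depends_fromD[OF dep])
      then show "1 + s * ((g x - e) / (4 * c)) = 1 + s * ((g y - e) / (4 * c))" by simp
    qed
    have p: "0 \<le> w s x" if "x \<in> \<Omega>" for x
      using w02[OF s that] by simp
    have o: "(\<integral>x. w s x \<partial>P) = 1"
      using i[OF g] prob_space unfolding w_def by (simp add: e_def)
    show ?th1 by (rule density_solution(1)[OF P b[OF s] d p o])
    show "\<And>d f. bounded_measurable d f \<Longrightarrow>
      (\<integral>x. f x \<partial>density P (\<lambda>x. ennreal (w s x))) = (\<integral>x. w s x * f x \<partial>P)"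
      by (rule density_solution(2)[OF P b[OF s] d p o])
  qed
  let ?R = "\<lambda>s. density P (\<lambda>x. ennreal (w s x))"
  have "measure P A = 1/2 * measure (?R 1) A + (1 - 1/2) * measure (?R (-1)) A" if A: "A \<in> sets P" for A
  proof -
    have AS: "A \<in> sets S" using A prob_on_S_D(2)[OF P'] by simp
    note bi = bounded_measurable_indicator[OF AS]
    have ms: "measure (?R s) A = (\<integral>x. w s x * indicator A x \<partial>P)" if "s = 1 \<or> s = -1" for s
      using int[OF that bi] A sets.sets_into_space[OF A] by (simp add: Int_absorb2)
    have "(\<integral>x. w 1 x * indicator A x \<partial>P) + (\<integral>x. w (-1) x * indicator A x \<partial>P) =
       (\<integral>x. w 1 x * indicator A x + w (-1) x * indicator A x \<partial>P)"
      by (intro Bochner_Integration.integral_add[symmetric] i[OF bounded_measurable_mult[OF b bi]]) simp_all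
    also have "\<dots> = (\<integral>x. 2 * indicator A x \<partial>P)"
    proof (intro Bochner_Integration.integral_cong refl)
      fix x
      have "w 1 x + w (-1) x = 2" unfolding w_def by linarith
      then show "w 1 x * indicator A x + w (-1) x * indicator A x = 2 * indicator A x"
        unfolding distrib_right[symmetric] by simp
    qed
    also have "\<dots> = 2 * measure P A" using A sets.sets_into_space[OF A] by (simp add: Int_absorb2)
    finally have sum: "measure (?R 1) A + measure (?R (-1)) A = 2 * measure P A"
      unfolding ms[OF disjI1[OF refl]] ms[OF disjI2[OF refl]] .
    have "(1 - 1/2 :: real) = 1/2" by simp
    then show ?thesis using sum by (simp only:)
  qed
  then have "?R 1 = P"
    by (intro extreme_measuresD[OF ext sol[OF disjI1[OF refl]] sol[OF disjI2[OF refl]], of "1/2"]) simp_all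
  then have "e = (\<integral>x. w 1 x * g x \<partial>P)"
    unfolding e_def by (metis int[OF disjI1[OF refl] g])
  also have "\<dots> = (\<integral>x. g x + ((g x)\<^sup>2 - e * g x) / (4 * c) \<partial>P)"
    by (intro Bochner_Integration.integral_cong refl) (simp add: w_def algebra_simps power2_eq_square)
  also have "\<dots> = e + ((\<integral>x. (g x)\<^sup>2 \<partial>P) - e * e) / (4 * c)"
    using i[OF g] i[OF bounded_measurable_power2[OF g]] by (simp add: e_def)
  finally show ?thesis using c by (simp add: e_def power2_eq_square)
qed

text \<open>
  The second moments of \<open>avg n f\<close> decrease, so by orthogonality of the increments the sequence is
  Cauchy in \<open>L\<^sup>2\<close>. An almost everywhere limit along a subsequence depends on no finite set of
  coordinates and has the mean of \<open>f\<close>, so by tail triviality its second moment is the square of that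
  mean. By monotonicity the second moments of the full sequence have the same limit.
\<close>

lemma extreme_avg_L2_tendsto:
  assumes ext: "P \<in> extreme_measures (solutions G T \<phi> \<mu>)" and f: "bounded_measurable c f" and c: "0 < c"
  shows "(\<lambda>n. \<integral>x. (avg n f x - (\<integral>y. f y \<partial>P))\<^sup>2 \<partial>P) \<longlonglongrightarrow> 0"
proof -
  note P = extreme_imp_solution[OF ext]
  have P': "prob_on_S P" and inv: "resampling_invariant P" using P solutions_iff by auto
  interpret prob_space P by (rule prob_on_S_D[OF P'])
  note [measurable_cong] = prob_on_S_D(2)[OF P']
  note sp = prob_on_S_D(3)[OF P']
  note i = bounded_measurable_integrable[OF P']
  note b = bounded_measurable_avg[OF f]
  have avm: "avg n f \<in> borel_measurable S" for n using b by (simp add: bounded_measurable_def)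
  have avmP [measurable]: "avg n f \<in> borel_measurable P" for n using avm by measurable
  define e where "e = (\<integral>y. f y \<partial>P)"
  define a where "a n = (\<integral>x. (avg n f x)\<^sup>2 \<partial>P)" for n
  have diff: "(\<integral>x. (avg m f x - avg n f x)\<^sup>2 \<partial>P) = \<bar>a m - a n\<bar>" for m n
  proof (cases "m \<le> n")
    case True
    have "0 \<le> (\<integral>x. (avg m f x - avg n f x)\<^sup>2 \<partial>P)" by simp
    with integral_avg_diff_square[OF P f True] show ?thesis by (simp add: a_def)
  next
    case False
    have "0 \<le> (\<integral>x. (avg n f x - avg m f x)\<^sup>2 \<partial>P)" by simp
    with integral_avg_diff_square[OF P f, of n m] False show ?thesis
      by (simp add: a_def power2_commute)
  qed
  have "decseq a"
  proof (rule decseq_SucI)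
    fix n
    have "0 \<le> (\<integral>x. (avg n f x - avg (Suc n) f x)\<^sup>2 \<partial>P)" by simp
    with integral_avg_diff_square[OF P f, of n "Suc n"] show "a (Suc n) \<le> a n" by (simp add: a_def)
  qed
  moreover have "0 \<le> a n" for n by (simp add: a_def)
  ultimately obtain L where L: "a \<longlonglongrightarrow> L" by (metis decseq_convergent)
  have Cau: "\<exists>N. \<forall>m\<ge>N. \<forall>n\<ge>N. (\<integral>x. (avg m f x - avg n f x)\<^sup>2 \<partial>P) < d" if "0 < d" for d
  proof -
    have "Cauchy a" using L by (rule LIMSEQ_imp_Cauchy)
    from CauchyD[OF this that] show ?thesis unfolding diff by simp
  qed
  have int2: "integrable P (\<lambda>x. (avg m f x - avg n f x)\<^sup>2)" for m n
    by (rule i[OF bounded_measurable_power2[OF bounded_measurable_diff[OF b b]]])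
  obtain r where r: "strict_mono r" and conv: "AE x in P. convergent (\<lambda>j. avg (r j) f x)"
    using L2_Cauchy_imp_AE_convergent_subseq[OF avmP int2 Cau] by auto
  \<comment> \<open>The limit exists only almost everywhere; truncation makes \<open>g\<close> bounded at every point and
    changes nothing where the limit exists.\<close>
  define g where "g x = max (- c) (min c (lim (\<lambda>j. avg (r j) f x)))" for x
  have gm [measurable]: "g \<in> borel_measurable S"
    unfolding g_def using avm by measurable
  have gb: "bounded_measurable c g"
    unfolding bounded_measurable_def using gm c by (auto simp: g_def)
  have gd: "depends_from n g" for n
  proof (rule depends_fromI)
    fix x y assume xy: "x \<in> \<Omega>" "y \<in> \<Omega>" "\<And>j. n \<le> j \<Longrightarrow> x j = y j"
    have "avg (r j) f x = avg (r j) f y" if "n \<le> j" for j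
    proof (rule depends_fromD[OF depends_from_avg xy(1,2)])
      fix k assume "r j \<le> k"
      then have "n \<le> k" using seq_suble[OF r, of j] that by simp
      then show "x k = y k" by (rule xy(3))
    qed
    then have ev: "\<forall>\<^sub>F j in sequentially. avg (r j) f x = avg (r j) f y"
      unfolding eventually_sequentially by auto
    have "lim (\<lambda>j. avg (r j) f x) = lim (\<lambda>j. avg (r j) f y)"
      unfolding lim_def by (simp add: tendsto_cong[OF ev])
    then show "g x = g y" by (simp add: g_def)
  qed
  have lim: "AE x in P. (\<lambda>j. avg (r j) f x) \<longlonglongrightarrow> g x"
    using conv AE_space
  proof eventually_elim
    case (elim x)
    then have x: "x \<in> \<Omega>" by (simp add: sp)
    from elim have l: "(\<lambda>j. avg (r j) f x) \<longlonglongrightarrow> lim (\<lambda>j. avg (r j) f x)"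
      by (simp add: convergent_LIMSEQ_iff)
    have "\<bar>avg (r j) f x\<bar> \<le> c" for j using b[of "r j"] x by (simp add: bounded_measurable_def)
    then have "- c \<le> avg (r j) f x" "avg (r j) f x \<le> c" for j by (simp_all add: abs_le_iff minus_le_iff)
    then have "- c \<le> lim (\<lambda>j. avg (r j) f x)" "lim (\<lambda>j. avg (r j) f x) \<le> c"
      using LIMSEQ_le_const[OF l] LIMSEQ_le_const2[OF l] by auto
    then have "g x = lim (\<lambda>j. avg (r j) f x)" by (simp add: g_def)
    then show ?case using l by simp
  qed
  have bound: "AE x in P. norm (avg (r j) f x) \<le> c" for j
    using b[of "r j"] by (intro AE_I2) (simp add: sp bounded_measurable_def)
  have "(\<lambda>j. \<integral>x. avg (r j) f x \<partial>P) \<longlonglongrightarrow> (\<integral>x. g x \<partial>P)"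
    by (rule integral_dominated_convergence[where w="\<lambda>_. c"]) (use lim bound in simp_all)
  then have ge: "(\<integral>x. g x \<partial>P) = e"
    unfolding integral_avg[OF inv f] e_def[symmetric] by (metis LIMSEQ_unique tendsto_const)
  have "(\<lambda>j. \<integral>x. (avg (r j) f x)\<^sup>2 \<partial>P) \<longlonglongrightarrow> (\<integral>x. (g x)\<^sup>2 \<partial>P)"
  proof (rule integral_dominated_convergence[where w="\<lambda>_. c * c"])
    show "AE x in P. (\<lambda>j. (avg (r j) f x)\<^sup>2) \<longlonglongrightarrow> (g x)\<^sup>2"
      using lim by eventually_elim (rule tendsto_power)
    show "AE x in P. norm ((avg (r j) f x)\<^sup>2) \<le> c * c" for j
      using bounded_measurable_power2[OF b[of "r j"]] by (intro AE_I2) (simp add: sp bounded_measurable_def)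
  qed simp_all
  then have "(\<lambda>j. a (r j)) \<longlonglongrightarrow> e\<^sup>2"
    unfolding a_def extreme_tail_trivial[OF ext gb c gd] ge .
  moreover have "(\<lambda>j. a (r j)) \<longlonglongrightarrow> L" using LIMSEQ_subseq_LIMSEQ[OF L r] by (simp add: o_def)
  ultimately have Le: "L = e\<^sup>2" by (rule LIMSEQ_unique[symmetric])
  have "(\<integral>x. (avg n f x - e)\<^sup>2 \<partial>P) = a n - e\<^sup>2" for n
  proof -
    have i2: "integrable P (\<lambda>x. (avg n f x)\<^sup>2)" by (rule i[OF bounded_measurable_power2[OF b]])
    have "(\<integral>x. (avg n f x - e)\<^sup>2 \<partial>P) = (\<integral>x. (avg n f x)\<^sup>2 + e\<^sup>2 - 2 * e * avg n f x \<partial>P)"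
      by (intro Bochner_Integration.integral_cong refl) (simp add: power2_diff mult.commute mult.left_commute)
    also have "\<dots> = a n + e\<^sup>2 - 2 * e * (\<integral>x. avg n f x \<partial>P)"
      using i2 i[OF b] prob_space by (simp add: a_def)
    also have "\<dots> = a n - e\<^sup>2"
      unfolding integral_avg[OF inv f] e_def[symmetric] by (simp add: power2_eq_square)
    finally show ?thesis .
  qed
  moreover have "(\<lambda>n. a n - e\<^sup>2) \<longlonglongrightarrow> 0"
    using tendsto_diff[OF L tendsto_const[of "e\<^sup>2"]] by (simp add: Le)
  ultimately show ?thesis by (simp add: e_def)
qed

text \<open>
  If the sum of the mean square deviations over \<open>F\<close> is below \<open>d\<^sup>2\<close>, some point has all
  deviations below \<open>d\<close>. The level \<open>n\<close> can be taken arbitrarily large, hence common to two extreme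
  solutions.
\<close>

lemma extreme_concentration:
  assumes ext: "P \<in> extreme_measures (solutions G T \<phi> \<mu>)" and fin: "finite F"
    and F: "\<And>f. f \<in> F \<Longrightarrow> \<exists>c>0. bounded_measurable c f" and d: "0 < d"
  shows "\<forall>\<^sub>F n in sequentially. \<exists>x\<in>\<Omega>. \<forall>f\<in>F. \<bar>avg n f x - (\<integral>y. f y \<partial>P)\<bar> < d"
proof -
  note P' = solution_prob_on_S[OF extreme_imp_solution[OF ext]]
  interpret prob_space P by (rule prob_on_S_D[OF P'])
  note sp = prob_on_S_D(3)[OF P']
  have "(\<lambda>n. \<Sum>f\<in>F. \<integral>x. (avg n f x - (\<integral>y. f y \<partial>P))\<^sup>2 \<partial>P) \<longlonglongrightarrow> (\<Sum>f\<in>F. 0)"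
  proof (rule tendsto_sum)
    fix f assume "f \<in> F"
    then obtain c where "c > 0" "bounded_measurable c f" using F by auto
    then show "(\<lambda>n. \<integral>x. (avg n f x - (\<integral>y. f y \<partial>P))\<^sup>2 \<partial>P) \<longlonglongrightarrow> 0"
      by (intro extreme_avg_L2_tendsto[OF ext])
  qed
  then have "(\<lambda>n. \<Sum>f\<in>F. \<integral>x. (avg n f x - (\<integral>y. f y \<partial>P))\<^sup>2 \<partial>P) \<longlonglongrightarrow> 0" by simp
  moreover have "0 < d\<^sup>2" using d by simp
  ultimately have "\<forall>\<^sub>F n in sequentially. (\<Sum>f\<in>F. \<integral>x. (avg n f x - (\<integral>y. f y \<partial>P))\<^sup>2 \<partial>P) < d\<^sup>2"
    by (rule order_tendstoD(2))
  then show ?thesis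
  proof eventually_elim
    case (elim n)
    have int: "integrable P (\<lambda>x. (avg n f x - (\<integral>y. f y \<partial>P))\<^sup>2)" if f: "f \<in> F" for f
    proof -
      obtain c where "bounded_measurable c f" using F[OF f] by auto
      from bounded_measurable_power2[OF bounded_measurable_diff[OF bounded_measurable_avg[OF this] bounded_measurable_const]]
      show ?thesis by (rule bounded_measurable_integrable[OF P'])
    qed
    let ?h = "\<lambda>x. \<Sum>f\<in>F. (avg n f x - (\<integral>y. f y \<partial>P))\<^sup>2"
    have ih: "integrable P ?h" by (rule Bochner_Integration.integrable_sum) (rule int)
    have "\<exists>x\<in>\<Omega>. ?h x < d\<^sup>2"
    proof (rule ccontr)
      assume "\<not> ?thesis"
      then have "d\<^sup>2 \<le> ?h x" if "x \<in> space P" for x using that sp by (simp add: not_less)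
      then have "(\<integral>x. d\<^sup>2 \<partial>P) \<le> (\<integral>x. ?h x \<partial>P)"
        by (intro integral_mono ih) simp_all
      also have "\<dots> = (\<Sum>f\<in>F. \<integral>x. (avg n f x - (\<integral>y. f y \<partial>P))\<^sup>2 \<partial>P)"
        by (rule Bochner_Integration.integral_sum) (rule int)
      finally show False using elim prob_space by simp
    qed
    then obtain x where x: "x \<in> \<Omega>" "?h x < d\<^sup>2" by auto
    have "\<bar>avg n f x - (\<integral>y. f y \<partial>P)\<bar> < d" if f: "f \<in> F" for f
    proof -
      have "(avg n f x - (\<integral>y. f y \<partial>P))\<^sup>2 \<le> ?h x"
        by (rule member_le_sum[OF f]) (use fin in simp_all)
      then have "\<bar>avg n f x - (\<integral>y. f y \<partial>P)\<bar>\<^sup>2 < d\<^sup>2" using x(2) by simp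
      then show ?thesis by (rule power2_less_imp_less) (use d in simp)
    qed
    then show ?case using x(1) by auto
  qed
qed

section \<open>Left translations\<close>

definition lmult :: "(nat \<Rightarrow> 'a) \<Rightarrow> (nat \<Rightarrow> 'a) \<Rightarrow> nat \<Rightarrow> 'a" where
  "lmult h x = (\<lambda>k. h k \<otimes>\<^bsub>G k\<^esub> x k)"

lemma lmult_closed [simp, intro]: "h \<in> \<Omega> \<Longrightarrow> x \<in> \<Omega> \<Longrightarrow> lmult h x \<in> \<Omega>"
  by (simp add: \<Omega>_iff lmult_def)

lemma measurable_lmult [measurable]:
  assumes "h \<in> \<Omega>"
  shows "lmult h \<in> measurable S S"
proof (rule measurable_S_I)
  fix k
  have "h k \<in> space (borel_of (T k))" using assms by simp
  then show "(\<lambda>x. lmult h x k) \<in> measurable S (borel_of (T k))"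
    unfolding lmult_def by (intro measurable_mult measurable_const measurable_component_S)
qed

lemma resample_lmult:
  assumes "h \<in> \<Omega>" "x \<in> \<Omega>" "z \<in> carrier (G n)" "h n = \<phi> n (h (Suc n))"
  shows "resample G \<phi> n (lmult h x) z = lmult h (resample G \<phi> n x z)"
proof
  fix k
  interpret Gn: group "G n" by (rule group_G)
  have "\<phi> n (h (Suc n) \<otimes>\<^bsub>G (Suc n)\<^esub> x (Suc n)) \<otimes>\<^bsub>G n\<^esub> z =
      h n \<otimes>\<^bsub>G n\<^esub> (\<phi> n (x (Suc n)) \<otimes>\<^bsub>G n\<^esub> z)"
    using assms by (simp add: phi_mult Gn.m_assoc)
  then show "resample G \<phi> n (lmult h x) z k = lmult h (resample G \<phi> n x z) k"
    by (simp add: resample_def lmult_def)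
qed

text \<open>
  Translation by \<open>h\<close> commutes with resampling the coordinate \<open>k\<close> as soon as
  \<open>h\<^sub>k = \<phi>\<^sub>k(h\<^sub>k\<^sub>+\<^sub>1)\<close>, because the noise is multiplied on the right;
  \<open>avg n\<close> resamples the coordinates below \<open>n\<close>.
\<close>

lemma avg_lmult:
  assumes h: "h \<in> \<Omega>"
  shows "(\<And>k. k < n \<Longrightarrow> h k = \<phi> k (h (Suc k))) \<Longrightarrow> x \<in> \<Omega> \<Longrightarrow>
    avg n f (lmult h x) = avg n (\<lambda>x. f (lmult h x)) x"
proof (induction n arbitrary: x)
  case (Suc n)
  have hn: "h n = \<phi> n (h (Suc n))" by (rule Suc.prems(1)) simp
  have "avg n f (resample G \<phi> n (lmult h x) z) = avg n (\<lambda>x. f (lmult h x)) (resample G \<phi> n x z)"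
    if "z \<in> space (\<mu> n)" for z
  proof -
    have z: "z \<in> carrier (G n)" using that by simp
    show ?thesis unfolding resample_lmult[OF h Suc.prems(2) z hn]
      using Suc.prems z by (intro Suc.IH) auto
  qed
  then show ?case unfolding avg.simps smooth_def
    by (intro Bochner_Integration.integral_cong refl)
qed simp

text \<open>
  The first \<open>n\<close> coordinates are recomputed from the one at index \<open>n\<close>, from the top down. The result
  satisfies the equations of \<open>H\<close> below level \<open>n\<close>.
\<close>

primrec push_down :: "nat \<Rightarrow> (nat \<Rightarrow> 'a) \<Rightarrow> nat \<Rightarrow> 'a" where
  "push_down 0 d = d"
| "push_down (Suc n) d = push_down n (d(n := \<phi> n (d (Suc n))))"

lemma push_down_closed: "d \<in> \<Omega> \<Longrightarrow> push_down n d \<in> \<Omega>"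
  by (induction n arbitrary: d) (simp_all add: \<Omega>_iff)

lemma push_down_above: "n \<le> j \<Longrightarrow> push_down n d j = d j"
  by (induction n arbitrary: d) simp_all

lemma push_down_below: "k < n \<Longrightarrow> push_down n d k = \<phi> k (push_down n d (Suc k))"
proof (induction n arbitrary: d)
  case (Suc n)
  show ?case
  proof (cases "k < n")
    case True
    then show ?thesis using Suc.IH by simp
  next
    case False
    then have "k = n" using Suc.prems by simp
    then show ?thesis by (simp add: push_down_above)
  qed
qed simp

section \<open>Transitivity of the action on extreme solutions\<close>

lemma compact_X: "compact_space X"
  by (simp add: compact_space_product_topology compact)

lemma Hausdorff_X: "Hausdorff_space X"
  by (simp add: Hausdorff_space_product_topology Hausdorff)

lemma second_countable_X: "second_countable X"
  unfolding second_countable_def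
  using second_countable_product_topology_nat[of T, OF second_countable] by (elim exE) auto

lemma continuous_bounded_measurable:
  assumes f: "continuous_map X euclideanreal f"
  shows "\<exists>c>0. bounded_measurable c f"
proof -
  have "compact (f ` \<Omega>)"
    using image_compactin[OF _ f, of \<Omega>] compact_X by (simp add: compact_space_def topspace_X)
  then have "bounded (f ` \<Omega>)" by (rule compact_imp_bounded)
  then obtain c where "0 < c" "\<forall>y\<in>f ` \<Omega>. norm y \<le> c" unfolding bounded_pos by auto
  moreover have "f \<in> borel_measurable S"
    using continuous_map_real_measurable_borel_of[OF f] by (simp only: measurable_cong_sets[OF sets_borel_X refl])
  ultimately show ?thesis by (auto simp: bounded_measurable_def)
qed

lemma continuous_lmult_pair: "continuous_map (prod_topology X X) X (\<lambda>p. lmult (fst p) (snd p))"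
  unfolding continuous_map_componentwise_UNIV
proof
  fix k
  have c: "continuous_map X (T k) (\<lambda>x. x k)"
    by (rule continuous_map_product_projection) simp
  have "continuous_map (prod_topology X X) (prod_topology (T k) (T k)) (\<lambda>p. (fst p k, snd p k))"
    using continuous_map_compose[OF continuous_map_fst c] continuous_map_compose[OF continuous_map_snd c]
    by (intro continuous_map_pairedI) (simp_all add: o_def)
  from continuous_map_compose[OF this continuous_mult]
  show "continuous_map (prod_topology X X) (T k) (\<lambda>p. lmult (fst p) (snd p) k)"
    by (simp add: o_def lmult_def)
qed

lemma continuous_lmult:
  assumes "h \<in> \<Omega>"
  shows "continuous_map X X (lmult h)"
proof -
  have "continuous_map X X (\<lambda>x. h)"
    using assms by (simp add: topspace_X del: topspace_product_topology)
  then have "continuous_map X (prod_topology X X) (\<lambda>x. (h, x))"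
    by (intro continuous_map_pairedI continuous_map_id[unfolded id_def])
  from continuous_map_compose[OF this continuous_lmult_pair] show ?thesis
    by (simp add: o_def)
qed

text \<open>
  The set of \<open>h\<close> for which some \<open>x\<close> violates the inequality is the projection of a closed subset of the
  product along a compact factor, hence closed.
\<close>

lemma uniform_nbhd:
  assumes f: "continuous_map X euclideanreal f" and h0: "h0 \<in> \<Omega>"
  shows "openin X {h \<in> \<Omega>. \<forall>x\<in>\<Omega>. \<bar>f (lmult h x) - f (lmult h0 x)\<bar> < e}"
proof -
  have 1: "continuous_map (prod_topology X X) euclideanreal (\<lambda>p. f (lmult (fst p) (snd p)))"
    using continuous_map_compose[OF continuous_lmult_pair f] by (simp add: o_def)
  have 2: "continuous_map (prod_topology X X) euclideanreal (\<lambda>p. f (lmult h0 (snd p)))"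
    using continuous_map_compose[OF continuous_map_compose[OF continuous_map_snd continuous_lmult[OF h0]] f]
    by (simp add: o_def)
  have "closedin (prod_topology X X) {p \<in> topspace (prod_topology X X).
      f (lmult (fst p) (snd p)) - f (lmult h0 (snd p)) \<in> {t. e \<le> \<bar>t\<bar>}}"
  proof (rule closedin_continuous_map_preimage[OF continuous_map_diff[OF 1 2]])
    have "closed {t::real. e \<le> \<bar>t\<bar>}" by (intro closed_Collect_le continuous_intros)
    then show "closedin euclideanreal {t. e \<le> \<bar>t\<bar>}" by simp
  qed
  then have "closedin X (fst ` {p \<in> topspace (prod_topology X X).
      f (lmult (fst p) (snd p)) - f (lmult h0 (snd p)) \<in> {t. e \<le> \<bar>t\<bar>}})" (is "closedin X ?C")
    using closed_map_fst[OF compact_X, of X] unfolding closed_map_def by simp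
  moreover have "?C = {h \<in> \<Omega>. \<exists>x\<in>\<Omega>. e \<le> \<bar>f (lmult h x) - f (lmult h0 x)\<bar>}"
    by (force simp: topspace_X simp del: topspace_product_topology)
  ultimately have "openin X (topspace X - {h \<in> \<Omega>. \<exists>x\<in>\<Omega>. e \<le> \<bar>f (lmult h x) - f (lmult h0 x)\<bar>})"
    by (intro openin_diff openin_topspace) simp
  moreover have "topspace X - {h \<in> \<Omega>. \<exists>x\<in>\<Omega>. e \<le> \<bar>f (lmult h x) - f (lmult h0 x)\<bar>} =
      {h \<in> \<Omega>. \<forall>x\<in>\<Omega>. \<bar>f (lmult h x) - f (lmult h0 x)\<bar> < e}"
    by (auto simp: topspace_X not_le simp del: topspace_product_topology)
  ultimately show ?thesis by simp
qed

text \<open>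
  The point \<open>x\<close> supplied by \<open>extreme_concentration\<close> determines the translation \<open>h\<close> that is used
  later, so concentration is needed uniformly in \<open>h\<close>. It suffices for finitely many translates of the
  test functions, up to a small uniform error.
\<close>

lemma finite_net:
  assumes fin: "finite F" and F: "\<And>f. f \<in> F \<Longrightarrow> continuous_map X euclideanreal f" and e: "0 < e"
  shows "\<exists>N. finite N \<and> N \<subseteq> \<Omega> \<and>
    (\<forall>h\<in>\<Omega>. \<exists>h0\<in>N. \<forall>f\<in>F. \<forall>x\<in>\<Omega>. \<bar>f (lmult h x) - f (lmult h0 x)\<bar> < e)"
proof -
  define U where "U h0 = {h \<in> \<Omega>. \<forall>f\<in>F. \<forall>x\<in>\<Omega>. \<bar>f (lmult h x) - f (lmult h0 x)\<bar> < e}" for h0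
  have "openin X (U h0)" if h0: "h0 \<in> \<Omega>" for h0
  proof -
    have "U h0 = \<Inter> (insert (topspace X) ((\<lambda>f. {h \<in> \<Omega>. \<forall>x\<in>\<Omega>. \<bar>f (lmult h x) - f (lmult h0 x)\<bar> < e}) ` F))"
      unfolding topspace_X by (auto simp: U_def)
    moreover have "openin X \<dots>"
      using fin F by (intro openin_Inter) (auto intro: uniform_nbhd[OF _ h0] simp del: topspace_product_topology)
    ultimately show ?thesis by simp
  qed
  moreover have "h \<in> U h" if "h \<in> \<Omega>" for h using that e by (simp add: U_def)
  ultimately have "(\<forall>V\<in>U ` \<Omega>. openin X V) \<and> topspace X \<subseteq> \<Union>(U ` \<Omega>)"
    unfolding topspace_X by auto
  with compact_X obtain \<F> where \<F>: "finite \<F>" "\<F> \<subseteq> U ` \<Omega>" "\<Omega> \<subseteq> \<Union>\<F>"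
    unfolding compact_space_alt topspace_X by meson
  obtain N where N: "N \<subseteq> \<Omega>" "finite N" "\<F> = U ` N"
    using finite_subset_image[OF \<F>(1,2)] by auto
  have "\<exists>h0\<in>N. \<forall>f\<in>F. \<forall>x\<in>\<Omega>. \<bar>f (lmult h x) - f (lmult h0 x)\<bar> < e" if "h \<in> \<Omega>" for h
  proof -
    obtain h0 where "h0 \<in> N" "h \<in> U h0" using \<F>(3) N(3) \<open>h \<in> \<Omega>\<close> by auto
    then show ?thesis by (auto simp: U_def)
  qed
  then show ?thesis using N by auto
qed

lemma integral_dist_le:
  assumes P: "prob_on_S P" and f: "bounded_measurable c f" and g: "bounded_measurable d g"
    and le: "\<And>x. x \<in> \<Omega> \<Longrightarrow> \<bar>f x - g x\<bar> \<le> e"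
  shows "\<bar>(\<integral>x. f x \<partial>P) - (\<integral>x. g x \<partial>P)\<bar> \<le> e"
proof -
  have "bounded_measurable e (\<lambda>x. f x - g x)"
    using f g le by (auto simp: bounded_measurable_def)
  from abs_integral_le[OF P this] show ?thesis
    using bounded_measurable_integrable[OF P f] bounded_measurable_integrable[OF P g] by simp
qed

lemma continuous_comp_lmult:
  "continuous_map X euclideanreal f \<Longrightarrow> h \<in> \<Omega> \<Longrightarrow> continuous_map X euclideanreal (\<lambda>x. f (lmult h x))"
  using continuous_map_compose[OF continuous_lmult] by (simp add: o_def)

text \<open>
  At suitable points \<open>x\<close> and \<open>y\<close> and a large level \<open>m\<close>, \<open>avg m f y\<close> is close to
  \<open>Q(f)\<close>, and \<open>avg m\<close> of the translate of \<open>f\<close> by \<open>h\<close>, evaluated at \<open>x\<close>, is close to the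
  integral of that translate under \<open>P\<close>. If \<open>h\<close> moves \<open>x\<close> to \<open>y\<close> from level \<open>m\<close> on and
  satisfies the equations of \<open>H\<close> below \<open>m\<close>, the two averages are equal.
\<close>

lemma approximate_translation:
  assumes P: "P \<in> extreme_measures (solutions G T \<phi> \<mu>)" and Q: "Q \<in> extreme_measures (solutions G T \<phi> \<mu>)"
    and fin: "finite F" and F: "\<And>f. f \<in> F \<Longrightarrow> continuous_map X euclideanreal f" and e: "0 < e"
  shows "\<exists>h\<in>\<Omega>. (\<forall>k<n. h k = \<phi> k (h (Suc k))) \<and>
    (\<forall>f\<in>F. \<bar>(\<integral>x. f x \<partial>Q) - (\<integral>x. f (lmult h x) \<partial>P)\<bar> \<le> e)"
proof -
  note P' = solution_prob_on_S[OF extreme_imp_solution[OF P]]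
  \<comment> \<open>Four errors add up: two from concentration, and two from replacing \<open>h\<close> by a point of the
    net, once inside the average and once inside the integral.\<close>
  define d where "d = e / 4"
  have d: "0 < d" using e by (simp add: d_def)
  obtain N where N: "finite N" "N \<subseteq> \<Omega>"
    "\<And>h. h \<in> \<Omega> \<Longrightarrow> \<exists>h0\<in>N. \<forall>f\<in>F. \<forall>x\<in>\<Omega>. \<bar>f (lmult h x) - f (lmult h0 x)\<bar> < d"
    using finite_net[OF fin F d] by auto
  define F' where "F' = (\<lambda>(f, h) x. f (lmult h x)) ` (F \<times> N)"
  have F': "finite F'" using fin N(1) by (simp add: F'_def)
  have F'b: "\<exists>c>0. bounded_measurable c g" if "g \<in> F'" for g
    using that N(2) F by (auto simp: F'_def intro!: continuous_bounded_measurable continuous_comp_lmult)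
  have "\<forall>\<^sub>F m in sequentially. \<exists>x\<in>\<Omega>. \<forall>f\<in>F'. \<bar>avg m f x - (\<integral>y. f y \<partial>P)\<bar> < d"
    by (rule extreme_concentration[OF P F' _ d]) (rule F'b)
  moreover have "\<forall>\<^sub>F m in sequentially. \<exists>x\<in>\<Omega>. \<forall>f\<in>F. \<bar>avg m f x - (\<integral>y. f y \<partial>Q)\<bar> < d"
    by (rule extreme_concentration[OF Q fin _ d]) (rule continuous_bounded_measurable[OF F])
  ultimately
  have "\<forall>\<^sub>F m in sequentially. (\<exists>x\<in>\<Omega>. \<forall>f\<in>F'. \<bar>avg m f x - (\<integral>y. f y \<partial>P)\<bar> < d) \<and>
      (\<exists>x\<in>\<Omega>. \<forall>f\<in>F. \<bar>avg m f x - (\<integral>y. f y \<partial>Q)\<bar> < d) \<and> n \<le> m"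
    using eventually_ge_at_top[of n] by eventually_elim simp
  then obtain m x y where m: "n \<le> m" and x: "x \<in> \<Omega>" "\<And>f. f \<in> F' \<Longrightarrow> \<bar>avg m f x - (\<integral>y. f y \<partial>P)\<bar> < d"
    and y: "y \<in> \<Omega>" "\<And>f. f \<in> F \<Longrightarrow> \<bar>avg m f y - (\<integral>y. f y \<partial>Q)\<bar> < d"
    by (auto dest!: eventually_happens'[OF sequentially_bot])
  define q where "q k = y k \<otimes>\<^bsub>G k\<^esub> inv\<^bsub>G k\<^esub> (x k)" for k
  define h where "h = push_down m q"
  have q: "q \<in> \<Omega>" using x(1) y(1) by (auto simp: \<Omega>_iff q_def)
  have h: "h \<in> \<Omega>" unfolding h_def by (rule push_down_closed[OF q])
  have hk: "h k = \<phi> k (h (Suc k))" if "k < m" for k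
    unfolding h_def by (rule push_down_below[OF that])
  have "lmult h x j = y j" if "m \<le> j" for j
  proof -
    interpret group "G j" by (rule group_G)
    show ?thesis using x(1) y(1) push_down_above[OF that, of q] by (simp add: lmult_def h_def q_def m_assoc)
  qed
  then have eq: "avg m f (lmult h x) = avg m f y" for f
    by (intro depends_fromD[OF depends_from_avg] lmult_closed h x(1) y(1))
  obtain h0 where h0: "h0 \<in> N" "\<And>f x. f \<in> F \<Longrightarrow> x \<in> \<Omega> \<Longrightarrow> \<bar>f (lmult h x) - f (lmult h0 x)\<bar> < d"
    using N(3)[OF h] by auto
  have h0\<Omega>: "h0 \<in> \<Omega>" using h0(1) N(2) by auto
  have "\<bar>(\<integral>x. f x \<partial>Q) - (\<integral>x. f (lmult h x) \<partial>P)\<bar> \<le> e" if f: "f \<in> F" for f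
  proof -
    obtain c1 c2 where b: "bounded_measurable c1 (\<lambda>x. f (lmult h x))" "bounded_measurable c2 (\<lambda>x. f (lmult h0 x))"
      using continuous_bounded_measurable[OF continuous_comp_lmult[OF F[OF f] h]]
        continuous_bounded_measurable[OF continuous_comp_lmult[OF F[OF f] h0\<Omega>]] by auto
    have "avg m f y = avg m (\<lambda>x. f (lmult h x)) x"
      unfolding eq[symmetric] by (rule avg_lmult[OF h hk x(1)])
    moreover have "\<bar>avg m (\<lambda>x. f (lmult h x)) x - avg m (\<lambda>x. f (lmult h0 x)) x\<bar> \<le> d"
      by (rule avg_dist_le[OF b x(1)]) (use h0(2)[OF f] in \<open>simp add: less_imp_le\<close>)
    moreover have "\<bar>(\<integral>x. f (lmult h x) \<partial>P) - (\<integral>x. f (lmult h0 x) \<partial>P)\<bar> \<le> d"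
      by (rule integral_dist_le[OF P' b]) (use h0(2)[OF f] in \<open>simp add: less_imp_le\<close>)
    moreover have "\<bar>avg m (\<lambda>x. f (lmult h0 x)) x - (\<integral>x. f (lmult h0 x) \<partial>P)\<bar> < d"
      using f h0(1) by (intro x(2)) (auto simp: F'_def)
    moreover note y(2)[OF f]
    ultimately show ?thesis unfolding d_def by linarith
  qed
  then show ?thesis using h hk m by (intro bexI[of _ h]) auto
qed

text \<open>
  By \<open>uniform_nbhd\<close> the integral of the translate varies continuously with \<open>h\<close>.
\<close>

lemma closedin_near_translations:
  assumes P: "prob_on_S P" and f: "continuous_map X euclideanreal f"
  shows "closedin X {h \<in> \<Omega>. \<bar>q - (\<integral>x. f (lmult h x) \<partial>P)\<bar> \<le> e}" (is "closedin X ?K")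
proof -
  have "openin X (topspace X - ?K)"
  proof (subst openin_subopen, intro ballI)
    fix h0 assume "h0 \<in> topspace X - ?K"
    then have h0: "h0 \<in> \<Omega>" and gt: "e < \<bar>q - (\<integral>x. f (lmult h0 x) \<partial>P)\<bar>"
      by (auto simp: topspace_X simp del: topspace_product_topology)
    define d where "d = (\<bar>q - (\<integral>x. f (lmult h0 x) \<partial>P)\<bar> - e) / 2"
    have d: "0 < d" using gt by (simp add: d_def)
    let ?U = "{h \<in> \<Omega>. \<forall>x\<in>\<Omega>. \<bar>f (lmult h x) - f (lmult h0 x)\<bar> < d}"
    have "?U \<subseteq> topspace X - ?K"
    proof
      fix h assume h: "h \<in> ?U"
      then have h\<Omega>: "h \<in> \<Omega>" by simp
      obtain c1 c2 where b: "bounded_measurable c1 (\<lambda>x. f (lmult h x))" "bounded_measurable c2 (\<lambda>x. f (lmult h0 x))"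
        using continuous_bounded_measurable[OF continuous_comp_lmult[OF f h\<Omega>]]
          continuous_bounded_measurable[OF continuous_comp_lmult[OF f h0]] by auto
      have "\<bar>(\<integral>x. f (lmult h x) \<partial>P) - (\<integral>x. f (lmult h0 x) \<partial>P)\<bar> \<le> d"
        by (rule integral_dist_le[OF P b]) (use h in \<open>simp add: less_imp_le\<close>)
      then have "e < \<bar>q - (\<integral>x. f (lmult h x) \<partial>P)\<bar>" using gt unfolding d_def by argo
      then show "h \<in> topspace X - ?K" using h\<Omega> by (simp add: topspace_X del: topspace_product_topology)
    qed
    then show "\<exists>U. openin X U \<and> h0 \<in> U \<and> U \<subseteq> topspace X - ?K"
      using uniform_nbhd[OF f h0, of d] h0 d by (intro exI[of _ ?U]) simp
  qed
  then show ?thesis unfolding closedin_def by (auto simp: topspace_X simp del: topspace_product_topology)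
qed

lemma closedin_compatible: "closedin X {h \<in> \<Omega>. \<forall>k<n. h k = \<phi> k (h (Suc k))}"
proof -
  have c: "continuous_map X (T k) (\<lambda>x. x k)" for k
    by (rule continuous_map_product_projection) simp
  have 1: "closedin X {h \<in> topspace X. h k = \<phi> k (h (Suc k))}" for k
    by (rule closedin_continuous_maps_eq[OF Hausdorff c])
      (use continuous_map_compose[OF c continuous_phi] in \<open>simp add: o_def\<close>)
  have "closedin X (\<Inter>(insert (topspace X) ((\<lambda>k. {h \<in> topspace X. h k = \<phi> k (h (Suc k))}) ` {..<n})))"
    using 1 by (intro closedin_Inter) (auto simp del: topspace_product_topology)
  moreover have "\<Inter>(insert (topspace X) ((\<lambda>k. {h \<in> topspace X. h k = \<phi> k (h (Suc k))}) ` {..<n})) =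
      {h \<in> \<Omega>. \<forall>k<n. h k = \<phi> k (h (Suc k))}"
    unfolding topspace_X by auto
  ultimately show ?thesis by simp
qed

lemma translate_eq_lmult:
  assumes "P \<in> solutions G T \<phi> \<mu>"
  shows "translate G T h P = distr P S (lmult h)"
  unfolding translate_def lmult_def by (rule distr_cong) (simp_all add: sets_borel_X)

lemma H_group_iff: "h \<in> H_group G \<phi> \<longleftrightarrow> h \<in> \<Omega> \<and> (\<forall>k. h k = \<phi> k (h (Suc k)))"
  by (simp add: H_group_def)

text \<open>
  The sets \<open>K (n, f, e)\<close> of translations that satisfy the equations of \<open>H\<close> below \<open>n\<close> and match
  the integrals of \<open>f\<close> up to \<open>e\<close> are closed and, by \<open>approximate_translation\<close>, have the finite
  intersection property. A common point of all of them lies in \<open>H\<close> and matches the integrals of all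
  continuous functions.
\<close>

theorem extreme_transitive:
  assumes P: "P \<in> extreme_measures (solutions G T \<phi> \<mu>)" and Q: "Q \<in> extreme_measures (solutions G T \<phi> \<mu>)"
  shows "\<exists>h\<in>H_group G \<phi>. translate G T h P = Q"
proof -
  note P' = solution_prob_on_S[OF extreme_imp_solution[OF P]]
  note Q' = solution_prob_on_S[OF extreme_imp_solution[OF Q]]
  define K where "K p = {h \<in> \<Omega>. \<forall>k<fst p. h k = \<phi> k (h (Suc k))} \<inter>
      {h \<in> \<Omega>. \<bar>(\<integral>x. fst (snd p) x \<partial>Q) - (\<integral>x. fst (snd p) (lmult h x) \<partial>P)\<bar> \<le> snd (snd p)}"
    for p :: "nat \<times> ((nat \<Rightarrow> 'a) \<Rightarrow> real) \<times> real"
  define I where "I = (UNIV :: nat set) \<times> {f. continuous_map X euclideanreal f} \<times> {0::real<..}"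
  have "\<Inter>(K ` I) \<noteq> {}"
  proof -
    have cl: "\<forall>C\<in>K ` I. closedin X C"
      unfolding K_def I_def
      by (auto intro!: closedin_Int closedin_compatible closedin_near_translations[OF P'])
    have "\<Inter>\<F> \<noteq> {}" if \<F>: "finite \<F>" "\<F> \<subseteq> K ` I" for \<F>
    proof -
      obtain J where J: "J \<subseteq> I" "finite J" "\<F> = K ` J"
        using finite_subset_image[OF \<F>] by auto
      define n where "n = Max (insert 0 (fst ` J))"
      define e where "e = Min (insert 1 ((snd \<circ> snd) ` J))"
      have e: "0 < e" unfolding e_def using J(1,2) by (subst Min_gr_iff) (auto simp: I_def)
      have "finite ((fst \<circ> snd) ` J)" using J(2) by simp
      moreover have "continuous_map X euclideanreal f" if "f \<in> (fst \<circ> snd) ` J" for f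
        using that J(1) by (auto simp: I_def)
      ultimately obtain h where h: "h \<in> \<Omega>" "\<And>k. k < n \<Longrightarrow> h k = \<phi> k (h (Suc k))"
        "\<And>f. f \<in> (fst \<circ> snd) ` J \<Longrightarrow> \<bar>(\<integral>x. f x \<partial>Q) - (\<integral>x. f (lmult h x) \<partial>P)\<bar> \<le> e"
        using approximate_translation[OF P Q _ _ e, of "(fst \<circ> snd) ` J" n] by auto
      have "h \<in> K p" if p: "p \<in> J" for p
      proof -
        have 1: "fst p \<le> n" unfolding n_def using J(2) p by (intro Max_ge) auto
        have 2: "e \<le> snd (snd p)" unfolding e_def using J(2) p by (intro Min_le) auto
        have 3: "\<bar>(\<integral>x. fst (snd p) x \<partial>Q) - (\<integral>x. fst (snd p) (lmult h x) \<partial>P)\<bar> \<le> e"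
          using p by (intro h(3)) auto
        show ?thesis unfolding K_def using h(1,2) 1 2 3 by auto
      qed
      then have "h \<in> \<Inter>\<F>" unfolding J(3) by (rule INT_I)
      then show ?thesis by blast
    qed
    then show ?thesis using compact_X cl unfolding compact_space_fip by simp
  qed
  then obtain h where h: "\<And>p. p \<in> I \<Longrightarrow> h \<in> K p" by auto
  have cont0: "continuous_map X euclideanreal (\<lambda>x. 0)" by simp
  have comp: "h \<in> \<Omega> \<and> h k = \<phi> k (h (Suc k))" for k
    using h[of "(Suc k, \<lambda>x. 0, 1)"] cont0 by (auto simp: I_def K_def)
  then have hH: "h \<in> H_group G \<phi>" unfolding H_group_iff by blast
  have h\<Omega>: "h \<in> \<Omega>" by (rule comp[THEN conjunct1])
  have int: "(\<integral>x. f x \<partial>Q) = (\<integral>x. f (lmult h x) \<partial>P)" if f: "continuous_map X euclideanreal f" for f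
  proof -
    have "\<bar>(\<integral>x. f x \<partial>Q) - (\<integral>x. f (lmult h x) \<partial>P)\<bar> \<le> 0 + e" if e: "0 < e" for e
    proof -
      have "(0, f, e) \<in> I" using f e by (simp add: I_def)
      from h[OF this] show ?thesis by (simp add: K_def)
    qed
    then have "\<bar>(\<integral>x. f x \<partial>Q) - (\<integral>x. f (lmult h x) \<partial>P)\<bar> \<le> 0"
      by (rule field_le_epsilon)
    then show ?thesis by simp
  qed
  interpret P: prob_space P by (rule prob_on_S_D[OF P'])
  have m: "lmult h \<in> measurable P S"
    using measurable_lmult[OF h\<Omega>] measurable_cong_sets[OF prob_on_S_D(2)[OF P'] refl] by blast
  have D: "prob_on_S (distr P S (lmult h))"
    using P.prob_space_distr[OF m] by (simp add: prob_on_S_def)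
  have "distr P S (lmult h) = Q"
  proof (rule measure_eqI_continuous_integrals[OF compact_X Hausdorff_X second_countable_X])
    show "borel_prob_measure X (distr P S (lmult h))" "borel_prob_measure X Q"
      using D Q' by (simp_all add: borel_prob_measure_X_iff)
    fix f assume f: "continuous_map X euclideanreal f"
    then have "f \<in> borel_measurable S"
      using continuous_bounded_measurable[OF f] by (auto simp: bounded_measurable_def)
    then show "(\<integral>x. f x \<partial>distr P S (lmult h)) = (\<integral>x. f x \<partial>Q)"
      unfolding int[OF f] by (rule integral_distr[OF m])
  qed
  then show ?thesis using hH translate_eq_lmult[OF extreme_imp_solution[OF P]] by auto
qed

section \<open>Conjugacy of stabilisers\<close>

lemma inv_mult_cancel:
  assumes "a \<in> carrier (G k)" "b \<in> carrier (G k)"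
  shows "inv\<^bsub>G k\<^esub> a \<otimes>\<^bsub>G k\<^esub> (a \<otimes>\<^bsub>G k\<^esub> b) = b"
proof -
  interpret group "G k" by (rule group_G)
  show ?thesis using assms by (simp add: m_assoc[symmetric])
qed

text \<open>
  The equation \<open>h\<^sub>k = \<phi>\<^sub>k(h\<^sub>k\<^sub>+\<^sub>1)\<close> loops as a rewrite rule, hence this form for single
  applications.
\<close>

lemma H_groupD:
  assumes "h \<in> H_group G \<phi>"
  shows "h \<in> \<Omega>" "h k = \<phi> k (h (Suc k))"
  using assms[unfolded H_group_iff] by blast+

lemma H_stab_iff:
  assumes "P \<in> solutions G T \<phi> \<mu>"
  shows "h \<in> H_stab G T \<phi> P \<longleftrightarrow> h \<in> H_group G \<phi> \<and> distr P S (lmult h) = P"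
  by (simp add: H_stab_def translate_eq_lmult[OF assms])

lemma measurable_lmult_solution:
  assumes "prob_on_S P" "h \<in> \<Omega>"
  shows "lmult h \<in> measurable P S"
  using measurable_lmult[OF assms(2)] by (simp only: measurable_cong_sets[OF prob_on_S_D(2)[OF assms(1)] refl])

lemma conjugate_H_group:
  assumes h: "h \<in> H_group G \<phi>" and s: "s \<in> H_group G \<phi>"
  shows "(\<lambda>k. h k \<otimes>\<^bsub>G k\<^esub> s k \<otimes>\<^bsub>G k\<^esub> inv\<^bsub>G k\<^esub> (h k)) \<in> H_group G \<phi>" (is "?t \<in> _")
  unfolding H_group_iff
proof (intro conjI allI)
  have h': "h \<in> \<Omega>" and s': "s \<in> \<Omega>" by (rule H_groupD[OF h] H_groupD[OF s])+
  then show "?t \<in> \<Omega>" by (simp add: \<Omega>_iff)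
next
  fix k
  have h': "h \<in> \<Omega>" and s': "s \<in> \<Omega>" by (rule H_groupD[OF h] H_groupD[OF s])+
  interpret group_hom "G (Suc k)" "G k" "\<phi> k" by (rule group_hom_phi)
  have "h k = \<phi> k (h (Suc k))" "s k = \<phi> k (s (Suc k))"
    by (rule H_groupD[OF h] H_groupD[OF s])+
  moreover have "\<phi> k (h (Suc k)) \<otimes>\<^bsub>G k\<^esub> \<phi> k (s (Suc k)) \<otimes>\<^bsub>G k\<^esub> inv\<^bsub>G k\<^esub> (\<phi> k (h (Suc k))) = \<phi> k (?t (Suc k))"
    using h' s' by simp
  ultimately show "?t k = \<phi> k (?t (Suc k))" by (simp only:)
qed

lemma stabiliser_conjugate:
  assumes P: "P \<in> solutions G T \<phi> \<mu>" and Q: "Q \<in> solutions G T \<phi> \<mu>"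
    and h: "h \<in> H_group G \<phi>" and hPQ: "translate G T h P = Q" and s: "s \<in> H_stab G T \<phi> P"
  shows "(\<lambda>k. h k \<otimes>\<^bsub>G k\<^esub> s k \<otimes>\<^bsub>G k\<^esub> inv\<^bsub>G k\<^esub> (h k)) \<in> H_stab G T \<phi> Q" (is "?t \<in> _")
proof -
  note P' = solution_prob_on_S[OF P]
  have sH: "s \<in> H_group G \<phi>" and sP: "distr P S (lmult s) = P" using s H_stab_iff[OF P] by auto
  have tH: "?t \<in> H_group G \<phi>" by (rule conjugate_H_group[OF h sH])
  have \<Omega>: "h \<in> \<Omega>" "s \<in> \<Omega>" "?t \<in> \<Omega>" by (rule H_groupD[OF h] H_groupD[OF sH] H_groupD[OF tH])+
  note m = measurable_lmult_solution[OF P']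
  have hQ: "distr P S (lmult h) = Q" using hPQ translate_eq_lmult[OF P] by simp
  have "distr Q S (lmult ?t) = distr P S (lmult ?t \<circ> lmult h)"
    unfolding hQ[symmetric] by (rule distr_distr[OF measurable_lmult[OF \<Omega>(3)] m[OF \<Omega>(1)]])
  also have "\<dots> = distr P S (lmult h \<circ> lmult s)"
  proof (rule distr_cong[OF refl refl])
    fix x assume "x \<in> space P"
    then have x: "x \<in> \<Omega>" by (simp add: prob_on_S_D[OF P'])
    show "(lmult ?t \<circ> lmult h) x = (lmult h \<circ> lmult s) x"
    proof
      fix k
      interpret group "G k" by (rule group_G)
      have "h k \<otimes>\<^bsub>G k\<^esub> s k \<otimes>\<^bsub>G k\<^esub> inv\<^bsub>G k\<^esub> (h k) \<otimes>\<^bsub>G k\<^esub> (h k \<otimes>\<^bsub>G k\<^esub> x k) =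
          h k \<otimes>\<^bsub>G k\<^esub> (s k \<otimes>\<^bsub>G k\<^esub> x k)"
        using \<Omega>(1,2) x by (simp add: m_assoc inv_mult_cancel)
      then show "(lmult ?t \<circ> lmult h) x k = (lmult h \<circ> lmult s) x k" by (simp add: lmult_def)
    qed
  qed
  also have "\<dots> = distr (distr P S (lmult s)) S (lmult h)"
    by (rule distr_distr[OF measurable_lmult[OF \<Omega>(1)] m[OF \<Omega>(2)], symmetric])
  also have "\<dots> = Q" unfolding sP hQ ..
  finally show ?thesis using tH H_stab_iff[OF Q] by simp
qed

lemma one_product: "\<one>\<^bsub>product_group UNIV G\<^esub> = (\<lambda>k. \<one>\<^bsub>G k\<^esub>)"
  by (simp add: restrict_def)

lemma conjugate_eq_one:
  assumes "h \<in> \<Omega>" "s \<in> \<Omega>" "(\<lambda>k. h k \<otimes>\<^bsub>G k\<^esub> s k \<otimes>\<^bsub>G k\<^esub> inv\<^bsub>G k\<^esub> (h k)) = (\<lambda>k. \<one>\<^bsub>G k\<^esub>)"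
  shows "s = (\<lambda>k. \<one>\<^bsub>G k\<^esub>)"
proof
  fix k
  interpret group "G k" by (rule group_G)
  have c: "h k \<in> carrier (G k)" "s k \<in> carrier (G k)" using assms by simp_all
  have "h k \<otimes>\<^bsub>G k\<^esub> s k \<otimes>\<^bsub>G k\<^esub> inv\<^bsub>G k\<^esub> (h k) = \<one>\<^bsub>G k\<^esub>" using fun_cong[OF assms(3), of k] .
  then have "h k \<otimes>\<^bsub>G k\<^esub> s k = h k" using c by (metis inv_closed inv_equality inv_inv m_closed)
  then show "s k = \<one>\<^bsub>G k\<^esub>" using c by (metis l_cancel_one)
qed

section \<open>The noise\<close>

lemma noise_closed: "x \<in> \<Omega> \<Longrightarrow> noise G \<phi> k x \<in> carrier (G k)"
  by (simp add: noise_def)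

lemma measurable_noise: "noise G \<phi> k \<in> measurable S (borel_of (T k))"
  unfolding noise_def
  by (intro measurable_mult measurable_inv measurable_phi measurable_component_S)

text \<open>
  The factor \<open>h\<^sub>k\<close> in front of \<open>x\<^sub>k\<close> cancels against \<open>\<phi>\<^sub>k(h\<^sub>k\<^sub>+\<^sub>1)\<close>.
\<close>

lemma noise_lmult:
  assumes h: "h \<in> H_group G \<phi>" and x: "x \<in> \<Omega>"
  shows "noise G \<phi> k (lmult h x) = noise G \<phi> k x"
proof -
  interpret group "G k" by (rule group_G)
  have hk: "h k = \<phi> k (h (Suc k))" and h\<Omega>: "h \<in> \<Omega>" by (rule H_groupD[OF h])+
  let ?a = "\<phi> k (h (Suc k))" and ?b = "\<phi> k (x (Suc k))"
  have c: "?a \<in> carrier (G k)" "?b \<in> carrier (G k)" "x k \<in> carrier (G k)" using h\<Omega> x by simp_all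
  have "noise G \<phi> k (lmult h x) = inv\<^bsub>G k\<^esub> (?a \<otimes>\<^bsub>G k\<^esub> ?b) \<otimes>\<^bsub>G k\<^esub> (?a \<otimes>\<^bsub>G k\<^esub> x k)"
    using h\<Omega> x by (simp add: noise_def lmult_def phi_mult hk[symmetric])
  also have "\<dots> = noise G \<phi> k x"
    using c by (simp add: noise_def inv_mult_group m_assoc inv_mult_cancel)
  finally show ?thesis .
qed

lemma noise_resample:
  assumes "x \<in> \<Omega>" "z \<in> carrier (G k)"
  shows "noise G \<phi> k (resample G \<phi> k x z) = z"
proof -
  interpret group "G k" by (rule group_G)
  have c: "\<phi> k (x (Suc k)) \<in> carrier (G k)" using assms by simp
  have "noise G \<phi> k (resample G \<phi> k x z) =
      inv\<^bsub>G k\<^esub> (\<phi> k (x (Suc k))) \<otimes>\<^bsub>G k\<^esub> (\<phi> k (x (Suc k)) \<otimes>\<^bsub>G k\<^esub> z)"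
    by (simp add: noise_def resample_def)
  then show ?thesis using c assms(2) by (simp add: inv_mult_cancel)
qed

lemma depends_from_noise: "depends_from k (\<lambda>x. f (noise G \<phi> k x))"
proof (rule depends_fromI)
  fix x y :: "nat \<Rightarrow> 'a" assume "\<And>j. k \<le> j \<Longrightarrow> x j = y j"
  then have "x k = y k" "x (Suc k) = y (Suc k)" by simp_all
  then show "f (noise G \<phi> k x) = f (noise G \<phi> k y)" by (simp add: noise_def)
qed

text \<open>
  After resampling the coordinate \<open>k\<close>, the noise at \<open>k\<close> is the fresh variable itself
  (\<open>noise_resample\<close>). The weight \<open>w\<close> serves the induction: it absorbs the last indicator of the
  noise together with everything later.
\<close>

lemma noise_independent:
  assumes P: "P \<in> solutions G T \<phi> \<mu>" and A: "\<And>j. A j \<in> sets (borel_of (T j))"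
  shows "bounded_measurable 1 w \<Longrightarrow> depends_from n w \<Longrightarrow>
    (\<integral>x. (\<Prod>j<n. indicator (A j) (noise G \<phi> j x)) * w x \<partial>P) = (\<Prod>j<n. measure (\<mu> j) (A j)) * (\<integral>x. w x \<partial>P)"
proof (induction n arbitrary: w)
  case (Suc n)
  have P': "prob_on_S P" and inv: "resampling_invariant P" using P solutions_iff by auto
  let ?i = "\<lambda>x. indicator (A n) (noise G \<phi> n x) :: real"
  have "(indicator (A n) :: 'a \<Rightarrow> real) \<in> borel_measurable (borel_of (T n))" using A by simp
  from measurable_compose[OF measurable_noise this]
  have bi: "bounded_measurable 1 ?i" by (simp add: bounded_measurable_def indicator_def)
  have b: "bounded_measurable 1 (\<lambda>x. w x * ?i x)"
    using bounded_measurable_mult[OF Suc.prems(1) bi] by simp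
  have dw: "depends_from n w" by (rule depends_from_mono[OF Suc.prems(2)]) simp
  have d: "depends_from n (\<lambda>x. w x * ?i x)"
  proof (rule depends_fromI)
    fix x y assume xy: "x \<in> \<Omega>" "y \<in> \<Omega>" "\<And>j. n \<le> j \<Longrightarrow> x j = y j"
    have "w x = w y" by (rule depends_fromD[OF dw xy])
    moreover have "?i x = ?i y" by (rule depends_fromD[OF depends_from_noise xy])
    ultimately show "w x * ?i x = w y * ?i y" by simp
  qed
  have "smooth n (\<lambda>x. w x * ?i x) x = measure (\<mu> n) (A n) * w x" if x: "x \<in> \<Omega>" for x
  proof -
    have "smooth n ?i x = (\<integral>z. indicator (A n) z \<partial>\<mu> n)"
      unfolding smooth_def by (intro Bochner_Integration.integral_cong refl) (simp add: noise_resample x)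
    also have "\<dots> = measure (\<mu> n) (A n)"
      using A[of n] sets.sets_into_space[OF A[of n]] by (simp add: sets_mu Int_absorb2)
    finally show ?thesis unfolding smooth_mult_depends[OF Suc.prems(2) x] by simp
  qed
  then have "(\<integral>x. smooth n (\<lambda>x. w x * ?i x) x \<partial>P) = (\<integral>x. measure (\<mu> n) (A n) * w x \<partial>P)"
    by (intro Bochner_Integration.integral_cong refl) (simp add: prob_on_S_D[OF P'])
  then have w: "(\<integral>x. w x * ?i x \<partial>P) = measure (\<mu> n) (A n) * (\<integral>x. w x \<partial>P)"
    using resampling_invariantD[OF inv b d] by simp
  have "(\<integral>x. (\<Prod>j<Suc n. indicator (A j) (noise G \<phi> j x)) * w x \<partial>P) =
      (\<integral>x. (\<Prod>j<n. indicator (A j) (noise G \<phi> j x)) * (w x * ?i x) \<partial>P)"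
    by (intro Bochner_Integration.integral_cong refl) (simp add: mult_ac)
  also have "\<dots> = (\<Prod>j<n. measure (\<mu> j) (A j)) * (\<integral>x. w x * ?i x \<partial>P)"
    by (rule Suc.IH[OF b d])
  finally show ?case unfolding w by simp
qed simp

definition noise_seq :: "(nat \<Rightarrow> 'a) \<Rightarrow> nat \<Rightarrow> 'a" where
  "noise_seq x = (\<lambda>k. noise G \<phi> k x)"

lemma measurable_noise_seq: "noise_seq \<in> measurable S S"
  by (rule measurable_S_I) (simp add: noise_seq_def measurable_noise)

lemma noise_seq_closed: "x \<in> \<Omega> \<Longrightarrow> noise_seq x \<in> \<Omega>"
  by (simp add: \<Omega>_iff noise_seq_def noise_closed)

text \<open>
  On boxes the law of the noise is the product of the values of the \<open>\<mu>\<^sub>k\<close>, the same for all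
  solutions.
\<close>

lemma noise_law_unique:
  assumes P: "P \<in> solutions G T \<phi> \<mu>" and Q: "Q \<in> solutions G T \<phi> \<mu>"
  shows "distr P S noise_seq = distr Q S noise_seq"
proof (rule measure_eqI_PiM_infinite)
  have m: "noise_seq \<in> measurable R S" if "R \<in> solutions G T \<phi> \<mu>" for R
    using measurable_noise_seq
    by (simp only: measurable_cong_sets[OF prob_on_S_D(2)[OF solution_prob_on_S[OF that]] refl])
  have fin: "prob_space (distr R S noise_seq)" if "R \<in> solutions G T \<phi> \<mu>" for R
    using prob_space.prob_space_distr[OF prob_on_S_D(1)[OF solution_prob_on_S[OF that]] m[OF that]] .
  interpret P: prob_space "distr P S noise_seq" by (rule fin[OF P])
  interpret Q: prob_space "distr Q S noise_seq" by (rule fin[OF Q])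
  show "finite_measure (distr P S noise_seq)" by (rule P.finite_measure_axioms)
  fix A J assume J: "finite J" "J \<subseteq> (UNIV :: nat set)" and A: "\<And>i. i \<in> J \<Longrightarrow> A i \<in> sets (borel_of (T i))"
  let ?E = "prod_emb UNIV (\<lambda>k. borel_of (T k)) J (Pi\<^sub>E J A)"
  \<comment> \<open>Unconstrained coordinates get the whole group, so that the product runs over an initial segment.\<close>
  define A' where "A' i = (if i \<in> J then A i else carrier (G i))" for i
  have A': "A' i \<in> sets (borel_of (T i))" for i
    using A[of i] sets.top[of "borel_of (T i)"] by (simp add: A'_def)
  obtain n where n: "J \<subseteq> {..<n}" using finite_nat_iff_bounded J(1) by auto
  have ES: "?E \<in> sets S" using J A by (intro sets_PiM_I) auto
  have iff: "x \<in> ?E \<longleftrightarrow> (\<forall>j<n. x j \<in> A' j)" if x: "x \<in> \<Omega>" for x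
  proof -
    have "x \<in> ?E \<longleftrightarrow> (\<forall>i\<in>J. x i \<in> A i)" using x by (auto simp: prod_emb_iff)
    also have "\<dots> \<longleftrightarrow> (\<forall>j<n. x j \<in> A' j)" using x n by (auto simp: A'_def)
    finally show ?thesis .
  qed
  have ind: "indicator ?E (noise_seq x) = (\<Prod>j<n. indicator (A' j) (noise G \<phi> j x)) * (1 :: real)" if x: "x \<in> \<Omega>" for x
  proof (cases "\<forall>j<n. noise G \<phi> j x \<in> A' j")
    case True
    then show ?thesis using iff[OF noise_seq_closed[OF x]] by (simp add: noise_seq_def)
  next
    case False
    then obtain j where "j < n" "noise G \<phi> j x \<notin> A' j" by auto
    then have "(\<Prod>j<n. indicator (A' j) (noise G \<phi> j x)) = (0 :: real)"
      by (intro prod_zero bexI[of _ j]) simp_all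
    then show ?thesis using False iff[OF noise_seq_closed[OF x]] by (simp add: noise_seq_def)
  qed
  have val: "measure (distr R S noise_seq) ?E = (\<Prod>j<n. measure (\<mu> j) (A' j))" if R: "R \<in> solutions G T \<phi> \<mu>" for R
  proof -
    note R' = solution_prob_on_S[OF R]
    interpret R: prob_space R by (rule prob_on_S_D[OF R'])
    have "measure (distr R S noise_seq) ?E = (\<integral>x. indicator ?E x \<partial>distr R S noise_seq)"
      using ES sets.sets_into_space[OF ES] by (simp add: Int_absorb2)
    also have "\<dots> = (\<integral>x. indicator ?E (noise_seq x) \<partial>R)"
      using ES by (intro integral_distr m[OF R]) simp
    also have "\<dots> = (\<integral>x. (\<Prod>j<n. indicator (A' j) (noise G \<phi> j x)) * 1 \<partial>R)"
      by (intro Bochner_Integration.integral_cong refl ind) (simp add: prob_on_S_D[OF R'])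
    also have "\<dots> = (\<Prod>j<n. measure (\<mu> j) (A' j)) * (\<integral>x. 1 \<partial>R)"
      by (rule noise_independent[OF R A']) (simp_all add: bounded_measurable_def depends_from_def)
    finally show ?thesis using R.prob_space by simp
  qed
  show "emeasure (distr P S noise_seq) ?E = emeasure (distr Q S noise_seq) ?E"
    by (simp add: P.emeasure_eq_measure Q.emeasure_eq_measure val[OF P] val[OF Q])
qed simp_all

lemma sets_noise_future: "sets (noise_future G T \<phi> k) =
    sigma_sets \<Omega> (\<Union>i\<in>{k..}. {noise G \<phi> i -` A \<inter> \<Omega> | A. A \<in> sets (borel_of (T i))})"
  unfolding noise_future_def sigma_gen_by_def topspace_X by (rule sets_measure_of) auto

text \<open>
  This transfers statements about the law of the whole noise sequence, and its invariance under
  translations, to events of \<open>noise_future\<close>.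
\<close>

lemma noise_future_vimage:
  assumes "B \<in> sets (noise_future G T \<phi> k)"
  shows "\<exists>C\<in>sets S. B = noise_seq -` C \<inter> \<Omega>"
  using assms unfolding sets_noise_future
proof (induction rule: sigma_sets.induct)
  case (Basic a)
  then obtain i A where i: "a = noise G \<phi> i -` A \<inter> \<Omega>" "A \<in> sets (borel_of (T i))" by blast
  have "(\<lambda>x. x i) -` A \<inter> \<Omega> \<in> sets S"
    using measurable_sets[OF measurable_component_S i(2)] by simp
  moreover have "a = noise_seq -` ((\<lambda>x. x i) -` A \<inter> \<Omega>) \<inter> \<Omega>"
    unfolding i(1) using noise_seq_closed by (auto simp: noise_seq_def)
  ultimately show ?case by (rule bexI[rotated])
next
  case Empty
  show ?case by (rule bexI[of _ "{}"]) simp_all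
next
  case (Compl a)
  then obtain C where C: "C \<in> sets S" "a = noise_seq -` C \<inter> \<Omega>" by blast
  have "\<Omega> - C \<in> sets S" using sets.compl_sets[OF C(1)] by simp
  moreover have "\<Omega> - a = noise_seq -` (\<Omega> - C) \<inter> \<Omega>"
    unfolding C(2) using noise_seq_closed by auto
  ultimately show ?case by (rule bexI[rotated])
next
  case (Union a)
  then have "\<forall>i. \<exists>C. C \<in> sets S \<and> a i = noise_seq -` C \<inter> \<Omega>" by blast
  from choice[OF this] obtain C where C: "\<forall>i. C i \<in> sets S \<and> a i = noise_seq -` C i \<inter> \<Omega>"
    by (elim exE)
  then have "(\<Union>i. C i) \<in> sets S" by (intro sets.countable_UN) auto
  moreover have "(\<Union>i. a i) = noise_seq -` (\<Union>i. C i) \<inter> \<Omega>" using C by auto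
  ultimately show ?case by (rule bexI[rotated])
qed

lemma solutions_agree_on_noise:
  assumes P: "P \<in> solutions G T \<phi> \<mu>" and Q: "Q \<in> solutions G T \<phi> \<mu>"
    and B: "B \<in> sets (noise_future G T \<phi> k)"
  shows "emeasure P B = emeasure Q B"
proof -
  obtain C where C: "C \<in> sets S" "B = noise_seq -` C \<inter> \<Omega>" using noise_future_vimage[OF B] by blast
  have "emeasure (distr R S noise_seq) C = emeasure R B" if "R \<in> solutions G T \<phi> \<mu>" for R
  proof -
    note R' = prob_on_S_D[OF solution_prob_on_S[OF that]]
    have "noise_seq \<in> measurable R S"
      using measurable_noise_seq by (simp only: measurable_cong_sets[OF R'(2) refl])
    from emeasure_distr[OF this C(1)] show ?thesis by (simp add: C(2) R'(3))
  qed
  then show ?thesis using noise_law_unique[OF P Q] P Q by metis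
qed

lemma sets_noise_future_S: "sets (noise_future G T \<phi> k) \<subseteq> sets S"
proof
  fix B assume "B \<in> sets (noise_future G T \<phi> k)"
  from noise_future_vimage[OF this] obtain C where C: "C \<in> sets S" "B = noise_seq -` C \<inter> \<Omega>" by blast
  show "B \<in> sets S" using measurable_sets[OF measurable_noise_seq C(1)] by (simp add: C(2))
qed

lemma noise_future_mono:
  assumes "m \<le> n"
  shows "sets (noise_future G T \<phi> n) \<subseteq> sets (noise_future G T \<phi> m)"
  unfolding sets_noise_future using assms by (intro sigma_sets_mono') (auto intro: order_trans)

lemma noise_future_lmult:
  assumes B: "B \<in> sets (noise_future G T \<phi> k)" and h: "h \<in> H_group G \<phi>" and x: "x \<in> \<Omega>"
  shows "lmult h x \<in> B \<longleftrightarrow> x \<in> B"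
proof -
  obtain C where C: "B = noise_seq -` C \<inter> \<Omega>" using noise_future_vimage[OF B] by blast
  have "noise_seq (lmult h x) = noise_seq x" by (simp add: noise_seq_def noise_lmult[OF h x])
  then show ?thesis using lmult_closed[OF H_groupD(1)[OF h] x] x by (simp add: C)
qed

section \<open>Strong solutions\<close>

text \<open>
  The events that agree almost surely with a noise event form a \<open>\<sigma>\<close>-algebra containing the null
  sets.
\<close>

lemma completed_noise_future:
  assumes P: "prob_on_S P"
    and A: "A \<in> sigma_sets \<Omega> (sets (noise_future G T \<phi> k) \<union> null_sets P)"
  shows "A \<in> sets S \<and> (\<exists>B\<in>sets (noise_future G T \<phi> k). AE x in P. x \<in> A \<longleftrightarrow> x \<in> B)"
  using A
proof (induction rule: sigma_sets.induct)
  case (Basic a)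
  then show ?case
  proof
    assume a: "a \<in> sets (noise_future G T \<phi> k)"
    then show ?thesis using sets_noise_future_S by (intro conjI bexI[of _ a]) auto
  next
    assume a: "a \<in> null_sets P"
    have "AE x in P. x \<in> a \<longleftrightarrow> x \<in> {}" using AE_not_in[OF a] by simp
    then show ?thesis
      using null_setsD2[OF a] prob_on_S_D(2)[OF P] by (intro conjI bexI[of _ "{}"]) simp_all
  qed
next
  case Empty
  show ?case by (intro conjI bexI[of _ "{}"]) simp_all
next
  case (Compl a)
  then obtain B where B: "a \<in> sets S" "B \<in> sets (noise_future G T \<phi> k)" "AE x in P. x \<in> a \<longleftrightarrow> x \<in> B" by blast
  have "\<Omega> - a \<in> sets S" using sets.compl_sets[OF B(1)] by simp
  moreover have "\<Omega> - B \<in> sets (noise_future G T \<phi> k)"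
    using B(2) unfolding sets_noise_future by (rule sigma_sets.Compl)
  moreover have "AE x in P. x \<in> \<Omega> - a \<longleftrightarrow> x \<in> \<Omega> - B" using B(3) by eventually_elim simp
  ultimately show ?case by blast
next
  case (Union a)
  then have "\<forall>i. \<exists>B. B \<in> sets (noise_future G T \<phi> k) \<and> (AE x in P. x \<in> a i \<longleftrightarrow> x \<in> B)" by blast
  from choice[OF this] obtain B where
    B: "\<forall>i. B i \<in> sets (noise_future G T \<phi> k) \<and> (AE x in P. x \<in> a i \<longleftrightarrow> x \<in> B i)" by (elim exE)
  have "(\<Union>i. a i) \<in> sets S" using Union by (intro sets.countable_UN) auto
  moreover have "(\<Union>i. B i) \<in> sets (noise_future G T \<phi> k)" using B by (intro sets.countable_UN) auto
  moreover have "AE x in P. \<forall>i. x \<in> a i \<longleftrightarrow> x \<in> B i" using B by (simp add: AE_all_countable)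
  then have "AE x in P. x \<in> (\<Union>i. a i) \<longleftrightarrow> x \<in> (\<Union>i. B i)" by eventually_elim simp
  ultimately show ?case by blast
qed

lemma strong_solutionD: "P \<in> strong_solutions G T \<phi> \<mu> \<Longrightarrow> P \<in> solutions G T \<phi> \<mu>"
  by (simp add: strong_solutions_def)

lemma strong_solution_coordinate_completed:
  assumes P: "P \<in> strong_solutions G T \<phi> \<mu>" and A: "A \<in> sets (borel_of (T k))"
  shows "{x \<in> \<Omega>. x k \<in> A} \<in> sigma_sets \<Omega> (sets (noise_future G T \<phi> k) \<union> null_sets P)"
proof -
  have m: "(\<lambda>x. x k) \<in> measurable (sigma (space P) (sets (noise_future G T \<phi> k) \<union> null_sets P)) (borel_of (T k))"
    using P by (simp add: strong_solutions_def)
  note sp = prob_on_S_D(3)[OF solution_prob_on_S[OF strong_solutionD[OF P]]]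
  have sub: "sets (noise_future G T \<phi> k) \<union> null_sets P \<subseteq> Pow \<Omega>"
  proof -
    have "a \<subseteq> \<Omega>" if "a \<in> sets (noise_future G T \<phi> k)" for a
      using sets_noise_future_S[THEN subsetD, OF that] sets.sets_into_space[of a S] by simp
    moreover have "a \<subseteq> \<Omega>" if "a \<in> null_sets P" for a
      using null_setsD2[OF that] sets.sets_into_space[of a P] sp by simp
    ultimately show ?thesis by blast
  qed
  have "{x \<in> \<Omega>. x k \<in> A} = (\<lambda>x. x k) -` A \<inter> \<Omega>" by auto
  then show ?thesis
    using measurable_sets[OF m A] sub by (simp add: sp space_measure_of_conv sets_measure_of)
qed

text \<open>
  An event of the coordinate \<open>k\<close> agrees almost surely with a noise event. The latter is invariant
  under translation by \<open>h\<close>, and the law is invariant as well, so \<open>x\<^sub>k\<close> and \<open>h\<^sub>k x\<^sub>k\<close>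
  almost surely lie in the same sets of a countable base and therefore coincide.
\<close>

lemma strong_solution_stabiliser_trivial:
  assumes P: "P \<in> strong_solutions G T \<phi> \<mu>" and h: "h \<in> H_stab G T \<phi> P"
  shows "h = (\<lambda>k. \<one>\<^bsub>G k\<^esub>)"
proof
  fix k
  have sol: "P \<in> solutions G T \<phi> \<mu>" using P by (simp add: strong_solutions_def)
  note P' = solution_prob_on_S[OF sol]
  note sp = prob_on_S_D(3)[OF P']
  interpret prob_space P by (rule prob_on_S_D[OF P'])
  have hH: "h \<in> H_group G \<phi>" and hP: "distr P S (lmult h) = P" using h H_stab_iff[OF sol] by blast+
  have h\<Omega>: "h \<in> \<Omega>" by (rule H_groupD[OF hH])
  have m: "lmult h \<in> measurable P S" by (rule measurable_lmult_solution[OF P' h\<Omega>])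
  have inv: "AE x in P. h k \<otimes>\<^bsub>G k\<^esub> x k \<in> A \<longleftrightarrow> x k \<in> A" if A: "A \<in> sets (borel_of (T k))" for A
  proof -
    from completed_noise_future[OF P' strong_solution_coordinate_completed[OF P A]]
    obtain B where B: "B \<in> sets (noise_future G T \<phi> k)" "AE x in P. x \<in> {x \<in> \<Omega>. x k \<in> A} \<longleftrightarrow> x \<in> B"
      by blast
    have "AE x in distr P S (lmult h). x \<in> {x \<in> \<Omega>. x k \<in> A} \<longleftrightarrow> x \<in> B" using B(2) by (simp only: hP)
    from AE_distrD[OF m this] have "AE x in P. lmult h x \<in> {x \<in> \<Omega>. x k \<in> A} \<longleftrightarrow> lmult h x \<in> B" .
    then show ?thesis using B(2) AE_space
    proof eventually_elim
      case (elim x)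
      then have x: "x \<in> \<Omega>" by (simp add: sp)
      have "lmult h x \<in> B \<longleftrightarrow> x \<in> B" by (rule noise_future_lmult[OF B(1) hH x])
      with elim x lmult_closed[OF h\<Omega> x] show ?case by (simp add: lmult_def)
    qed
  qed
  obtain \<B> where \<B>: "countable \<B>" "\<forall>V\<in>\<B>. openin (T k) V"
    "\<forall>U x. openin (T k) U \<and> x \<in> U \<longrightarrow> (\<exists>V\<in>\<B>. x \<in> V \<and> V \<subseteq> U)"
    using second_countable[of k] unfolding second_countable_def by (elim exE conjE)
  have "AE x in P. \<forall>V\<in>\<B>. h k \<otimes>\<^bsub>G k\<^esub> x k \<in> V \<longleftrightarrow> x k \<in> V"
    using \<B>(1,2) inv by (subst AE_ball_countable) auto
  then have "AE x in P. \<exists>y\<in>\<Omega>. \<forall>V\<in>\<B>. h k \<otimes>\<^bsub>G k\<^esub> y k \<in> V \<longleftrightarrow> y k \<in> V"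
    using AE_space by eventually_elim (auto simp: sp)
  then obtain x where x: "x \<in> \<Omega>" "\<forall>V\<in>\<B>. h k \<otimes>\<^bsub>G k\<^esub> x k \<in> V \<longleftrightarrow> x k \<in> V"
    by auto
  interpret Gk: group "G k" by (rule group_G)
  have c: "h k \<in> carrier (G k)" "x k \<in> carrier (G k)" using h\<Omega> x(1) by simp_all
  have "h k \<otimes>\<^bsub>G k\<^esub> x k = x k"
  proof (rule ccontr)
    assume "h k \<otimes>\<^bsub>G k\<^esub> x k \<noteq> x k"
    moreover have "x k \<in> topspace (T k)" "h k \<otimes>\<^bsub>G k\<^esub> x k \<in> topspace (T k)" using c by simp_all
    ultimately obtain U V where UV: "openin (T k) U" "x k \<in> U" "h k \<otimes>\<^bsub>G k\<^esub> x k \<in> V" "disjnt U V"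
      using Hausdorff[of k] unfolding Hausdorff_space_def by metis
    then obtain W where W: "W \<in> \<B>" "x k \<in> W" "W \<subseteq> U" using \<B>(3) by blast
    then have "h k \<otimes>\<^bsub>G k\<^esub> x k \<in> U" using x(2) by blast
    then show False using UV(3,4) by (auto simp: disjnt_def)
  qed
  then show "h k = \<one>\<^bsub>G k\<^esub>" using c by simp
qed

lemma strong_solution_approx:
  assumes P: "P \<in> strong_solutions G T \<phi> \<mu>" and A: "A \<in> sets S"
  shows "\<exists>B\<in>sets (noise_future G T \<phi> 0). AE x in P. x \<in> A \<longleftrightarrow> x \<in> B"
proof -
  note P' = solution_prob_on_S[OF strong_solutionD[OF P]]
  let ?N = "\<lambda>k. sets (noise_future G T \<phi> k) \<union> null_sets P"
  have "{x \<in> \<Omega>. x i \<in> A} \<in> sigma_sets \<Omega> (?N 0)" if "A \<in> sets (borel_of (T i))" for i A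
  proof -
    have "sigma_sets \<Omega> (?N i) \<subseteq> sigma_sets \<Omega> (?N 0)"
      using noise_future_mono[of 0 i] by (intro sigma_sets_mono') auto
    then show ?thesis using strong_solution_coordinate_completed[OF P that] by blast
  qed
  then have "sigma_sets \<Omega> {{x \<in> \<Omega>. x i \<in> A} |i A. A \<in> sets (borel_of (T i))} \<subseteq> sigma_sets \<Omega> (?N 0)"
    by (intro sigma_sets_mono) auto
  moreover have "A \<in> sigma_sets \<Omega> {{x \<in> \<Omega>. x i \<in> A} |i A. A \<in> sets (borel_of (T i))}"
    using A unfolding sets_PiM_single by simp
  ultimately have "A \<in> sigma_sets \<Omega> (?N 0)" by blast
  from completed_noise_future[OF P' this] show ?thesis by blast
qed

text \<open>
  Domination carries the almost sure equality of an event with a noise event from \<open>P\<close> to \<open>Q\<close>, and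
  \<open>P\<close> and \<open>Q\<close> agree on noise events.
\<close>

lemma strong_solution_unique_dominated:
  assumes P: "P \<in> strong_solutions G T \<phi> \<mu>" and Q: "Q \<in> solutions G T \<phi> \<mu>"
    and ac: "\<And>A. A \<in> sets P \<Longrightarrow> emeasure P A = 0 \<Longrightarrow> emeasure Q A = 0"
  shows "Q = P"
proof (rule measure_eqI)
  note sol = strong_solutionD[OF P]
  note P' = solution_prob_on_S[OF sol] and Q' = solution_prob_on_S[OF Q]
  have sets: "sets Q = sets P" using prob_on_S_D(2)[OF P'] prob_on_S_D(2)[OF Q'] by simp
  then show "sets Q = sets P" .
  fix A assume "A \<in> sets Q"
  then have A: "A \<in> sets S" using prob_on_S_D(2)[OF Q'] by simp
  obtain B where B: "B \<in> sets (noise_future G T \<phi> 0)" "AE x in P. x \<in> A \<longleftrightarrow> x \<in> B"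
    using strong_solution_approx[OF P A] by blast
  have BS: "B \<in> sets S" using B(1) sets_noise_future_S by blast
  have "AE x in Q. x \<in> A \<longleftrightarrow> x \<in> B"
  proof -
    obtain N where N: "{x \<in> space P. \<not> (x \<in> A \<longleftrightarrow> x \<in> B)} \<subseteq> N" "emeasure P N = 0" "N \<in> sets P"
      using B(2) by (rule AE_E)
    have "emeasure Q N = 0" by (rule ac[OF N(3,2)])
    moreover have "N \<in> sets Q" using N(3) sets by simp
    moreover have "{x \<in> space Q. \<not> (x \<in> A \<longleftrightarrow> x \<in> B)} \<subseteq> N"
      using N(1) prob_on_S_D(3)[OF P'] prob_on_S_D(3)[OF Q'] by simp
    ultimately show ?thesis by (intro AE_I)
  qed
  then have "emeasure Q A = emeasure Q B"
    using A BS prob_on_S_D(2)[OF Q'] by (intro emeasure_eq_AE) auto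
  also have "\<dots> = emeasure P B" by (rule solutions_agree_on_noise[OF Q sol B(1)])
  also have "\<dots> = emeasure P A"
    using A BS prob_on_S_D(2)[OF P'] B(2) by (intro emeasure_eq_AE) auto
  finally show "emeasure Q A = emeasure P A" .
qed

text \<open>
  The components of a convex combination with positive weights vanish on the null sets of the
  combination.
\<close>

lemma strong_solution_extreme:
  assumes P: "P \<in> strong_solutions G T \<phi> \<mu>"
  shows "P \<in> extreme_measures (solutions G T \<phi> \<mu>)"
  unfolding extreme_measures_def
proof (intro CollectI conjI ballI allI impI)
  note sol = strong_solutionD[OF P]
  show "P \<in> solutions G T \<phi> \<mu>" by (rule sol)
  fix Q R t
  assume Q: "Q \<in> solutions G T \<phi> \<mu>" and R: "R \<in> solutions G T \<phi> \<mu>"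
  assume "0 < t \<and> t < (1::real) \<and>
      (\<forall>A\<in>sets P. measure P A = t * measure Q A + (1 - t) * measure R A)"
  then have t: "0 < t" "t < 1"
    and eq: "\<And>A. A \<in> sets P \<Longrightarrow> measure P A = t * measure Q A + (1 - t) * measure R A" by auto
  interpret P: prob_space P by (rule prob_on_S_D[OF solution_prob_on_S[OF sol]])
  interpret Q: prob_space Q by (rule prob_on_S_D[OF solution_prob_on_S[OF Q]])
  interpret R: prob_space R by (rule prob_on_S_D[OF solution_prob_on_S[OF R]])
  have null: "measure Q A = 0 \<and> measure R A = 0" if A: "A \<in> sets P" and 0: "emeasure P A = 0" for A
  proof -
    have "measure P A = 0" using 0 by (simp add: measure_def)
    then have "t * measure Q A + (1 - t) * measure R A = 0" using eq[OF A] by simp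
    moreover have "0 \<le> t * measure Q A" "0 \<le> (1 - t) * measure R A" using t by simp_all
    ultimately have "t * measure Q A = 0" "(1 - t) * measure R A = 0" by linarith+
    then show ?thesis using t by simp
  qed
  show "Q = P"
    by (rule strong_solution_unique_dominated[OF P Q]) (use null in \<open>simp add: Q.emeasure_eq_measure\<close>)
  show "R = P"
    by (rule strong_solution_unique_dominated[OF P R]) (use null in \<open>simp add: R.emeasure_eq_measure\<close>)
qed

theorem nontrivial_stabiliser_transfers:
  assumes P: "P \<in> extreme_measures (solutions G T \<phi> \<mu>)" and Q: "Q \<in> extreme_measures (solutions G T \<phi> \<mu>)"
    and s: "s \<in> H_stab G T \<phi> P" "s \<noteq> (\<lambda>k. \<one>\<^bsub>G k\<^esub>)"
  shows "\<exists>s\<in>H_stab G T \<phi> Q. s \<noteq> (\<lambda>k. \<one>\<^bsub>G k\<^esub>)"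
proof -
  note P' = extreme_imp_solution[OF P] and Q' = extreme_imp_solution[OF Q]
  obtain h where h: "h \<in> H_group G \<phi>" "translate G T h P = Q"
    using extreme_transitive[OF P Q] by blast
  have "s \<in> H_group G \<phi>" using s(1) H_stab_iff[OF P'] by blast
  then show ?thesis
    using stabiliser_conjugate[OF P' Q' h s(1)] conjugate_eq_one[of h s] H_groupD(1)[OF h(1)] H_groupD(1)[of s] s(2)
    by blast
qed

end

theorem corollary2p15:
  fixes G :: "nat \<Rightarrow> ('a, 'b) monoid_scheme"
    and T :: "nat \<Rightarrow> 'a topology"
    and \<phi> :: "nat \<Rightarrow> 'a \<Rightarrow> 'a"
    and \<mu> :: "nat \<Rightarrow> 'a measure"
  assumes "\<And>k. topological_group (G k) (T k)"
    and "\<And>k. compact_space (T k)"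
    and "\<And>k. Hausdorff_space (T k)"
    and "\<And>k. second_countable (T k)"
    and "\<And>k. \<phi> k \<in> hom (G (Suc k)) (G k)"
    and "\<And>k. continuous_map (T (Suc k)) (T k) (\<phi> k)"
    and "\<And>k. borel_prob_measure (T k) (\<mu> k)"
    and "\<exists>P0\<in>extreme_measures (solutions G T \<phi> \<mu>).
           \<exists>h\<in>H_stab G T \<phi> P0. h \<noteq> \<one>\<^bsub>product_group UNIV G\<^esub>"
  shows "(\<forall>P0\<in>extreme_measures (solutions G T \<phi> \<mu>).
            \<exists>h\<in>H_stab G T \<phi> P0. h \<noteq> \<one>\<^bsub>product_group UNIV G\<^esub>) \<and>
         strong_solutions G T \<phi> \<mu> = {}"
proof
  interpret compact_group_chain G T \<phi> \<mu>
    using assms(1-7) by (rule compact_group_chain.intro)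
  obtain P s where P: "P \<in> extreme_measures (solutions G T \<phi> \<mu>)"
    and s: "s \<in> H_stab G T \<phi> P" "s \<noteq> \<one>\<^bsub>product_group UNIV G\<^esub>"
    using assms(8) by blast
  show all: "\<forall>P0\<in>extreme_measures (solutions G T \<phi> \<mu>).
      \<exists>h\<in>H_stab G T \<phi> P0. h \<noteq> \<one>\<^bsub>product_group UNIV G\<^esub>"
    using nontrivial_stabiliser_transfers[OF P _ s(1)] s(2) unfolding one_product by blast
  show "strong_solutions G T \<phi> \<mu> = {}"
  proof (rule equals0I)
    fix Q assume Q: "Q \<in> strong_solutions G T \<phi> \<mu>"
    then obtain h where "h \<in> H_stab G T \<phi> Q" "h \<noteq> \<one>\<^bsub>product_group UNIV G\<^esub>"
      using all strong_solution_extreme by blast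
    then show False using strong_solution_stabiliser_trivial[OF Q] unfolding one_product by blast
  qed
qed
end
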